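(* Let $d\ge1$, $T>0$. Assume: (a) $F,G:\mathbb{R}^d\times\mathcal{P}_1(\mathbb{R}^d)\to\mathbb{R}$ are continuous. (b) $G(\cdot,\eta)\in C^2(\mathbb{R}^d)$ for every $\eta\in\mathcal{P}_1(\mathbb{R}^d)$, and there are constants $C_{F,1},C_{F,2},C_{G,1},C_{G,2}>0$ such that for all $\eta\in\mathcal{P}_1(\mathbb{R}^d)$ and $x,y\in\mathbb{R}^d$: $|F(x,\eta)|\le C_{F,1}$; $|F(x,\eta)-F(y,\eta)|\le C_{F,2}|x-y|$; $\operatorname{supp}(G(\cdot,\eta))\subseteq \overline{B}(0,C_{G,1})$; $\sup_{x}\{|G(x,\eta)|+|D_xG(x,\eta)|+|D_x^2G(x,\eta)|\}\le C_{G,2}$. (c) $m_0^*\in\mathcal{P}_1(\mathbb{R}^d)$ is absolutely continuous with density (still denoted $m_0^*$) in $C^2(\mathbb{R}^d)$ and $\operatorname{supp}(m_0^* )\subseteq\overline{B}(0,C^* )$ for some $C^*>0$. (d) $H(x,p)=\sup_{a\in\mathbb{R}^d}(a\cdot p-L(x,a))$ for all $x,p\in\mathbb{R}^d$, where $L\in C^2(\mathbb{R}^d\times\mathbb{R}^d)$ is bounded from below and there are constants $C_{L,1},\dots,C_{L,5}>0$ such that for all $x,a,b,y\in\mathbb{R}^d$: $L(x,a)\le C_{L,1}|a|^2+C_{L,2}$; $|D_xL(x,a)|\le C_{L,3}(1+|a|^2)$; $C_{L,4}|b|^2\le D^2_{aa}L(x,a)b\cdot b$; $D^2_{xx}L(x,a)y\cdot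 y\le C_{L,5}(1+|a|^2)|y|^2$. Let $\Delta=(\Delta x,\Delta t)>0$ (with $T/\Delta t\in\mathbb{N}$) be such that $\Delta x<c\,\Delta t$ for some $c>0$. Then there exists at least one solution $(m,v)\in\mathcal{S}(\mathcal{G}_\Delta)\times\mathcal{B}(\mathcal{G}_\Delta)$ of the scheme $(MFG^1_d)$.
   Context: **General.** $\mathcal{P}_1(\mathbb{R}^d)$ is the set of probability measures on $\mathbb{R}^d$ with finite first moment, with the Kantorovich–Rubinstein distance $d_1$. $|\cdot|$ is the Euclidean norm, $|\cdot|_\infty$ the maximum norm; $\overline{B}(0,R)$, $\overline{B}_\infty(0,R)$ are the corresponding closed balls. $\mathcal{B}(E;E')$ denotes bounded functions from $E$ to $E'$, and $\mathcal{B}(E)=\mathcal{B}(E;\mathbb{R})$. **Constants.** Under the assumptions on $L$, $H\in C^2$ and there is $C_{H,5}>0$ with $|D_pH(x,p)|\le C_{H,5}(1+|p|)$ for all $x,p$. $C_{\rm b}>0$ is a fixed constant bounding, uniformly in $\eta\in C([0,T];\mathcal{P}_1(\mathbb{R}^d))$ and $(x,t)$, the $L^\infty$ norm of the optimal controls of $\inf_\alpha\int_t^T[L(\gamma(s),\alpha(s))+F(\gamma(s),\eta(s))]ds+G(\gamma(T),\eta(T))$, $\dot\gamma=-\alpha$, $\gamma(t)=x$. Set $C_H:=C_{\rm b}+C_{H,5}(C_{G,2}+1)$. **Grids.** Given $\Delta=(\Delta x,\Delta t)$ with $N_T\Delta t=T$, $N_T\in\mathbb{N}_+$: $i\in\mathbb{Z}^d$,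 $k\in\{0,\dots,N_T\}$, $x_i=i\Delta x$, $t_k=k\Delta t$, $E_i=\{x:|x-x_i|_\infty\le\Delta x/2\}$; $\mathcal{G}_{\Delta x}=\{x_i\}$, $\mathcal{G}_\Delta=\{(x_i,t_k)\}$; $\mathcal{G}^*_\Delta$ and the index set $\mathcal{I}_\Delta^*$ are those with $k\le N_T-1$. Write $u_{i,k}=u(x_i,t_k)$, $u_k=(u_{i,k})_i$. The $\mathbb{Q}_1$ basis is $\beta_i(x)=\prod_{l=1}^d\max\{0,1-|x_l-(x_i)_l|/\Delta x\}$, and $I_{\Delta x}[W]=\sum_iW_i\beta_i$. $\mathcal{S}(\mathcal{G}_{\Delta x})=\{z:z_i\ge0,\sum_iz_i=1\}$ and $\mathcal{S}(\mathcal{G}_\Delta)=\{(\eta_k)_{k=0}^{N_T}:\eta_k\in\mathcal{S}(\mathcal{G}_{\Delta x})\}$. $M_{\Delta x}[\eta](x)=\Delta x^{-d}\sum_i\eta_i\chi_{E_i}(x)$ (identified with the measure having this density). **Discrete couplings.** $f(x_i,\eta)=\Delta x^{-d}\int_{E_i}F(x,M_{\Delta x}[\eta])dx$, $g(x_i,\eta)=\Delta x^{-d}\int_{E_i}G(x,M_{\Delta x}[\eta])dx$. **Discrete controls.** For $v\in\mathcal{B}(\mathcal{G}_\Delta)$ and $(i,k)\in\mathcal{I}_\Delta^*$, $\Lambda_{i,k}[v]=\arg\min_{a\in\overline{B}_\infty(0,C_H)}\{I_{\Delta x}[v_{k+1}](x_i-\Delta t\,a)+\Delta t\,L(x_i,a)\}$;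 $\Lambda_\Delta[v]=\{q\in\mathcal{B}(\mathcal{G}^*_\Delta;\mathbb{R}^d):q_{i,k}\in\Lambda_{i,k}[v]\}$; $\mathcal{M}_\Delta[v]=\{(\mu_{i,k})_{(i,k)\in\mathcal{I}^*_\Delta}:\mu_{i,k}\in\mathcal{P}_1(\mathbb{R}^d),\operatorname{supp}\mu_{i,k}\subseteq\Lambda_{i,k}[v]\}$. **Scheme $(MFG^1_d)$.** $(m,v)\in\mathcal{S}(\mathcal{G}_\Delta)\times\mathcal{B}(\mathcal{G}_\Delta)$ is a solution if for some $q\in\Lambda_\Delta[v]$, $\mu\in\mathcal{M}_\Delta[v]$: for all $(i,k)\in\mathcal{I}_\Delta^*$, $v_{i,k}=I_{\Delta x}[v_{k+1}](x_i-\Delta t\,q_{i,k})+\Delta t\,L(x_i,q_{i,k})+\Delta t\,f(x_i,m_k)$, $\ m_{i,k+1}=\sum_jm_{j,k}\int_{\mathbb{R}^d}\beta_i(x_j-\Delta t\,a)\,d\mu_{j,k}(a)$, and for all $i$, $v_{i,N_T}=g(x_i,m_{N_T})$, $m_{i,0}=\int_{E_i}dm_0^*$. *)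

theory Defs
  imports "HOL-Probability.Probability"
begin

definition grad :: "('a::euclidean_space \<Rightarrow> real) \<Rightarrow> 'a \<Rightarrow> 'a" where
  "grad f x = (\<Sum>b\<in>Basis. frechet_derivative f (at x) b *\<^sub>R b)"

text \<open>The Hessian at a point, as a linear map: \<open>hess f x b \<bullet> b\<close> is the quadratic form
  \<open>D\<^sup>2f(x)b \<cdot> b\<close>, and the norm of \<open>D\<^sup>2f(x)\<close> is the operator norm \<open>onorm (hess f x)\<close>.\<close>
definition hess :: "('a::euclidean_space \<Rightarrow> real) \<Rightarrow> 'a \<Rightarrow> 'a \<Rightarrow> 'a" where
  "hess f x = frechet_derivative (grad f) (at x)"

definition C2 :: "('a::euclidean_space \<Rightarrow> real) \<Rightarrow> bool" where
  "C2 f \<longleftrightarrow> (\<forall>x. f differentiable (at x)) \<and> (\<forall>x. grad f differentiable (at x)) \<and>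
     (\<forall>b. continuous_on UNIV (\<lambda>x. hess f x b))"

definition fun_supp :: "('a::topological_space \<Rightarrow> real) \<Rightarrow> 'a set" where
  "fun_supp f = closure {x. f x \<noteq> 0}"

definition P1 :: "'a::euclidean_space measure set" where
  "P1 = {\<mu>. prob_space \<mu> \<and> sets \<mu> = sets borel \<and> integrable \<mu> norm}"

text \<open>The Kantorovich--Rubinstein distance. It is meaningful on \<open>P1\<close>, where the set over which
  the supremum is taken is bounded.\<close>
definition d1 :: "'a::euclidean_space measure \<Rightarrow> 'a measure \<Rightarrow> real" where
  "d1 \<mu> \<nu> = (SUP \<phi>\<in>{\<phi> :: 'a \<Rightarrow> real. 1-lipschitz_on UNIV \<phi>}. (\<integral>x. \<phi> x \<partial>\<mu>) - (\<integral>x. \<phi> x \<partial>\<nu>))"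

definition meas_supp :: "'a::topological_space measure \<Rightarrow> 'a set" where
  "meas_supp \<mu> = {x. \<forall>U. open U \<and> x \<in> U \<longrightarrow> emeasure \<mu> U > 0}"

text \<open>Couplings are total functions on all measures; only their values on \<open>P1\<close> are constrained.\<close>
definition continuous_coupling ::
  "('a::euclidean_space \<Rightarrow> 'a measure \<Rightarrow> real) \<Rightarrow> bool" where
  "continuous_coupling F \<longleftrightarrow>
     (\<forall>x. \<forall>\<mu>\<in>P1. \<forall>e>0. \<exists>\<delta>>0. \<forall>y. \<forall>\<nu>\<in>P1.
        dist y x < \<delta> \<and> d1 \<nu> \<mu> < \<delta> \<longrightarrow> \<bar>F y \<nu> - F x \<mu>\<bar> < e)"

definition continuous_curves :: "real \<Rightarrow> (real \<Rightarrow> 'a::euclidean_space measure) set" where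
  "continuous_curves T = {\<eta>. (\<forall>t\<in>{0..T}. \<eta> t \<in> P1) \<and>
     (\<forall>t\<in>{0..T}. ((\<lambda>s. d1 (\<eta> s) (\<eta> t)) \<longlongrightarrow> 0) (at t within {0..T}))}"

definition hamiltonian :: "('a::euclidean_space \<Rightarrow> 'a \<Rightarrow> real) \<Rightarrow> 'a \<Rightarrow> 'a \<Rightarrow> real" where
  "hamiltonian L x p = (SUP a. a \<bullet> p - L x a)"

text \<open>Controls on \<open>[t,T]\<close> are square integrable; the state solves \<open>\<gamma>' = -\<alpha>\<close> a.e., \<open>\<gamma>(t) = x\<close>.\<close>
definition controls :: "real \<Rightarrow> real \<Rightarrow> (real \<Rightarrow> 'a::euclidean_space) set" where
  "controls T t = {\<alpha>. set_borel_measurable lborel {t..T} \<alpha> \<and>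
     set_integrable lborel {t..T} (\<lambda>s. (norm (\<alpha> s))\<^sup>2)}"

definition state :: "real \<Rightarrow> 'a::euclidean_space \<Rightarrow> (real \<Rightarrow> 'a) \<Rightarrow> real \<Rightarrow> 'a" where
  "state t x \<alpha> s = x - (LBINT r:{t..s}. \<alpha> r)"

definition control_cost ::
  "('a::euclidean_space \<Rightarrow> 'a \<Rightarrow> real) \<Rightarrow> ('a \<Rightarrow> 'a measure \<Rightarrow> real) \<Rightarrow> ('a \<Rightarrow> 'a measure \<Rightarrow> real)
     \<Rightarrow> real \<Rightarrow> (real \<Rightarrow> 'a measure) \<Rightarrow> 'a \<Rightarrow> real \<Rightarrow> (real \<Rightarrow> 'a) \<Rightarrow> real" where
  "control_cost L F G T \<eta> x t \<alpha> =
     (LBINT s:{t..T}. L (state t x \<alpha> s) (\<alpha> s) + F (state t x \<alpha> s) (\<eta> s))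
       + G (state t x \<alpha> T) (\<eta> T)"

definition bounds_optimal_controls ::
  "('a::euclidean_space \<Rightarrow> 'a \<Rightarrow> real) \<Rightarrow> ('a \<Rightarrow> 'a measure \<Rightarrow> real) \<Rightarrow> ('a \<Rightarrow> 'a measure \<Rightarrow> real)
     \<Rightarrow> real \<Rightarrow> real \<Rightarrow> bool" where
  "bounds_optimal_controls L F G T C \<longleftrightarrow>
     (\<forall>\<eta>\<in>continuous_curves T. \<forall>x. \<forall>t\<in>{0..T}. \<forall>\<alpha>.
        is_arg_min (control_cost L F G T \<eta> x t) (\<lambda>\<alpha>. \<alpha> \<in> controls T t) \<alpha> \<longrightarrow>
        (AE s in lborel. s \<in> {t..T} \<longrightarrow> norm (\<alpha> s) \<le> C))"

text \<open>A function on the space grid is indexed by \<open>i :: int ^ 'n\<close>. A function \<open>u\<close> on the space-time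
  grid is written \<open>u k i\<close>, time index first, so that \<open>u k\<close> is its time slice; only \<open>k \<le> N\<close>
  (or \<open>k < N\<close> for functions on the grid without the final time) is relevant.
  The parameters \<open>dx\<close>, \<open>dt\<close> are the mesh sizes and \<open>N\<close> is the number of time steps.\<close>

definition gridpt :: "real \<Rightarrow> int ^ 'n \<Rightarrow> real ^ 'n" where
  "gridpt dx i = (\<chi> l. real_of_int (i $ l) * dx)"

definition cell :: "real \<Rightarrow> int ^ 'n \<Rightarrow> (real ^ 'n) set" where
  "cell dx i = {x. infnorm (x - gridpt dx i) \<le> dx / 2}"

definition Q1basis :: "real \<Rightarrow> int ^ 'n \<Rightarrow> real ^ 'n \<Rightarrow> real" where
  "Q1basis dx i x = (\<Prod>l\<in>UNIV. max 0 (1 - \<bar>x $ l - gridpt dx i $ l\<bar> / dx))"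

text \<open>At each point only finitely many terms of the following sum, and of the one defining
  the density in \<open>grid_measure\<close>, are nonzero.\<close>
definition interp :: "real \<Rightarrow> (int ^ 'n \<Rightarrow> real) \<Rightarrow> real ^ 'n \<Rightarrow> real" where
  "interp dx W x = (\<Sum>\<^sub>\<infinity>i. W i * Q1basis dx i x)"

definition grid_simplex :: "(int ^ 'n \<Rightarrow> real) set" where
  "grid_simplex = {z. (\<forall>i. 0 \<le> z i) \<and> (z has_sum 1) UNIV}"

definition grid_flows :: "nat \<Rightarrow> (nat \<Rightarrow> int ^ 'n \<Rightarrow> real) set" where
  "grid_flows N = {m. \<forall>k\<le>N. m k \<in> grid_simplex}"

definition grid_bounded :: "nat \<Rightarrow> (nat \<Rightarrow> int ^ 'n \<Rightarrow> real) set" where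
  "grid_bounded N = {v. bounded {v k i | k i. k \<le> N}}"

definition grid_measure :: "real \<Rightarrow> (int ^ 'n \<Rightarrow> real) \<Rightarrow> (real ^ 'n) measure" where
  "grid_measure dx z =
     density lborel (\<lambda>x. ennreal (1 / dx ^ CARD('n) * (\<Sum>\<^sub>\<infinity>i. z i * indicator (cell dx i) x)))"

text \<open>The discrete couplings \<open>f\<close> and \<open>g\<close> are \<open>cell_average dx F\<close> and \<open>cell_average dx G\<close>.\<close>
definition cell_average ::
  "real \<Rightarrow> (real ^ 'n \<Rightarrow> (real ^ 'n) measure \<Rightarrow> real) \<Rightarrow> int ^ 'n \<Rightarrow> (int ^ 'n \<Rightarrow> real) \<Rightarrow> real" where
  "cell_average dx F i z = 1 / dx ^ CARD('n) * (LBINT x:cell dx i. F x (grid_measure dx z))"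

definition argmin_controls ::
  "real \<Rightarrow> real \<Rightarrow> real \<Rightarrow> (real ^ 'n \<Rightarrow> real ^ 'n \<Rightarrow> real) \<Rightarrow> (nat \<Rightarrow> int ^ 'n \<Rightarrow> real)
     \<Rightarrow> nat \<Rightarrow> int ^ 'n \<Rightarrow> (real ^ 'n) set" where
  "argmin_controls dx dt CH L v k i =
     {a. is_arg_min
           (\<lambda>a. interp dx (v (Suc k)) (gridpt dx i - dt *\<^sub>R a) + dt * L (gridpt dx i) a)
           (\<lambda>a. infnorm a \<le> CH) a}"

definition pure_controls ::
  "real \<Rightarrow> real \<Rightarrow> nat \<Rightarrow> real \<Rightarrow> (real ^ 'n \<Rightarrow> real ^ 'n \<Rightarrow> real) \<Rightarrow> (nat \<Rightarrow> int ^ 'n \<Rightarrow> real)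
     \<Rightarrow> (nat \<Rightarrow> int ^ 'n \<Rightarrow> real ^ 'n) set" where
  "pure_controls dx dt N CH L v =
     {q. bounded {q k i | k i. k < N} \<and> (\<forall>k<N. \<forall>i. q k i \<in> argmin_controls dx dt CH L v k i)}"

definition mixed_controls ::
  "real \<Rightarrow> real \<Rightarrow> nat \<Rightarrow> real \<Rightarrow> (real ^ 'n \<Rightarrow> real ^ 'n \<Rightarrow> real) \<Rightarrow> (nat \<Rightarrow> int ^ 'n \<Rightarrow> real)
     \<Rightarrow> (nat \<Rightarrow> int ^ 'n \<Rightarrow> (real ^ 'n) measure) set" where
  "mixed_controls dx dt N CH L v =
     {\<mu>. \<forall>k<N. \<forall>i. \<mu> k i \<in> P1 \<and> meas_supp (\<mu> k i) \<subseteq> argmin_controls dx dt CH L v k i}"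

definition MFG_solution ::
  "real \<Rightarrow> real \<Rightarrow> nat \<Rightarrow> real \<Rightarrow> (real ^ 'n \<Rightarrow> real ^ 'n \<Rightarrow> real)
     \<Rightarrow> (real ^ 'n \<Rightarrow> (real ^ 'n) measure \<Rightarrow> real) \<Rightarrow> (real ^ 'n \<Rightarrow> (real ^ 'n) measure \<Rightarrow> real)
     \<Rightarrow> (real ^ 'n) measure \<Rightarrow> (nat \<Rightarrow> int ^ 'n \<Rightarrow> real) \<Rightarrow> (nat \<Rightarrow> int ^ 'n \<Rightarrow> real) \<Rightarrow> bool" where
  "MFG_solution dx dt N CH L F G m0 m v \<longleftrightarrow>
     m \<in> grid_flows N \<and> v \<in> grid_bounded N \<and>
     (\<exists>q\<in>pure_controls dx dt N CH L v. \<exists>\<mu>\<in>mixed_controls dx dt N CH L v.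
        (\<forall>k<N. \<forall>i.
           v k i = interp dx (v (Suc k)) (gridpt dx i - dt *\<^sub>R q k i)
                     + dt * L (gridpt dx i) (q k i) + dt * cell_average dx F i (m k) \<and>
           m (Suc k) i =
             (\<Sum>\<^sub>\<infinity>j. m k j * (\<integral>a. Q1basis dx i (gridpt dx j - dt *\<^sub>R a) \<partial>\<mu> k j))) \<and>
        (\<forall>i. v N i = cell_average dx G i (m N) \<and> m 0 i = measure m0 (cell dx i)))"

end

theory Submission
  imports Defs
begin

text \<open>Since \<open>m0\<close> has compact support and controls are bounded, the mass at time \<open>k\<close> lives on a finite
  set of nodes, so existence is a finite-dimensional fixed-point problem. Replace the set of optimal
  controls by a probability vector on a finite net of actions that charges only \<open>e\<close>-optimal actions
  and depends continuously on the value function. Brouwer's theorem for the map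
  value function \<open>\<mapsto>\<close> transported mass \<open>\<mapsto>\<close> value function then gives an \<open>e\<close>-equilibrium. Caratheodory's
  theorem bounds the number of atoms of the mixed controls independently of \<open>e\<close>, so that weights
  and atoms converge along a subsequence as \<open>e \<rightarrow> 0\<close>; the limiting atoms are optimal.\<close>

section \<open>Fixed points and convex combinations in term-indexed dimension\<close>

text \<open>The interpolated value need not be convex in the action, so the optimal actions may form
  a nonconvex set that jumps as the values vary. Mixing actions makes the attainable transition
  weights convex, and the smoothed choice replaces a fixed-point theorem for set-valued maps by one
  for continuous maps. The values live on the whole grid, but the masses determine them by backward
  recursion, and the cost of an action at a node involves only the values on a finite stencil. Hence
  only values at nodes that mass can reach enter the fixed-point loop; all others are read off
  afterwards. An action influences the masses only through the vector of its transition weights on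
  the stencil. Caratheodory's theorem is applied to that vector, which gives one atom more than the
  stencil has nodes. Both the tolerance e and the mesh of the net are 1/(n+1); continuity in the
  action then extends the comparison from the nets to all admissible actions.\<close>

text \<open>Indices are added one at a time: a further subsequence makes the new coordinate converge
  and leaves the earlier limits unchanged.\<close>

lemma finite_family_convergent_subsequence:
  fixes x :: "nat \<Rightarrow> 'i \<Rightarrow> 'a::metric_space"
  assumes "finite I" and "\<And>i. i \<in> I \<Longrightarrow> compact (C i)"
    and "\<And>n i. i \<in> I \<Longrightarrow> x n i \<in> C i"
  obtains r :: "nat \<Rightarrow> nat" and l where "strict_mono r"
    and "\<And>i. i \<in> I \<Longrightarrow> l i \<in> C i" and "\<And>i. i \<in> I \<Longrightarrow> (\<lambda>n. x (r n) i) \<longlonglongrightarrow> l i"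
  using assms
proof (induction I arbitrary: thesis rule: finite_induct)
  case empty
  show ?case by (rule empty(1)[of id]) (auto simp: strict_mono_id)
next
  case (insert j I)
  obtain r l where r: "strict_mono r" "\<And>i. i \<in> I \<Longrightarrow> l i \<in> C i"
    "\<And>i. i \<in> I \<Longrightarrow> (\<lambda>n. x (r n) i) \<longlonglongrightarrow> l i"
    using insert.IH insert.prems by (metis insertCI)
  have "\<forall>n. x (r n) j \<in> C j" using insert.prems by auto
  moreover have "compact (C j)" using insert.prems by auto
  ultimately obtain a s where s: "a \<in> C j" "strict_mono s" "((\<lambda>n. x (r n) j) \<circ> s) \<longlonglongrightarrow> a"
    unfolding compact_def by metis
  have "(\<lambda>n. x ((r \<circ> s) n) i) \<longlonglongrightarrow> l i" if "i \<in> I" for i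
    using LIMSEQ_subseq_LIMSEQ[OF r(3)[OF that] s(2)] by (simp add: o_def)
  then show ?case
    using s r insert.hyps strict_mono_o[OF r(1) s(2)]
    by (intro insert.prems(1)[of "r \<circ> s" "l(j := a)"]) (auto simp: comp_def)
qed

text \<open>The dimension \<open>card I\<close> is a term here, so the theorem \<open>brouwer\<close> for Euclidean types does not
  apply. Sequential continuity lets the labelled vertices of Kuhn's lemma pass to the limit.\<close>
lemma brouwer_box:
  fixes f :: "('i \<Rightarrow> real) \<Rightarrow> 'i \<Rightarrow> real"
  assumes fin: "finite I" and B: "B \<ge> 0"
    and range: "\<And>x i. \<lbrakk>\<And>i. i \<in> I \<Longrightarrow> \<bar>x i\<bar> \<le> B; i \<in> I\<rbrakk> \<Longrightarrow> \<bar>f x i\<bar> \<le> B"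
    and cont: "\<And>X x i. \<lbrakk>\<And>n i. i \<in> I \<Longrightarrow> \<bar>X n i\<bar> \<le> B; \<And>i. i \<in> I \<Longrightarrow> (\<lambda>n. X n i) \<longlonglongrightarrow> x i; i \<in> I\<rbrakk>
       \<Longrightarrow> (\<lambda>n. f (X n) i) \<longlonglongrightarrow> f x i"
  obtains x where "\<And>i. i \<in> I \<Longrightarrow> \<bar>x i\<bar> \<le> B" "\<And>i. i \<in> I \<Longrightarrow> f x i = x i"
proof -
  define d where "d = card I"
  obtain h where h: "bij_betw h {0..<d} I" using ex_bij_betw_nat_finite[OF fin] unfolding d_def by blast
  define g where "g = the_inv_into {0..<d} h"
  have hI: "h k \<in> I" if "k < d" for k using h that by (auto simp: bij_betw_def)
  have gI: "g i < d" "h (g i) = i" if "i \<in> I" for i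
    using bij_betw_the_inv_into[OF h] f_the_inv_into_f_bij_betw[OF h, of i] that
    by (auto simp: bij_betw_def g_def)
  \<comment> \<open>\<open>pt p\<close> maps the lattice {0..p}^d affinely onto a grid of mesh 2B/p
    in the box, with \<open>g\<close> numbering the coordinates.\<close>
  define pt where "pt p y i = 2 * B * (real (y (g i)) / real p) - B" for p and y :: "nat \<Rightarrow> nat" and i
  \<comment> \<open>Label 0 means that \<open>f\<close> does not decrease the coordinate, label 1
    that it does not increase it. Kuhn's lemma wants label 1 on the top face; forcing it there is
    consistent, because the coordinate already equals its maximum B.\<close>
  define lab where "lab p y k = (if y k = p then 1 else if f (pt p y) (h k) \<ge> pt p y (h k) then 0 else 1 :: nat)"
    for p y k
  have gh: "g (h k) = k" if "k < d" for k
    using h that the_inv_into_f_f[of h "{0..<d}" k] by (auto simp: bij_betw_def g_def)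
  have pt_box: "\<bar>pt p y i\<bar> \<le> B" if "\<forall>k<d. y k \<le> p" "p > 0" "i \<in> I" for p y i
  proof -
    have "0 \<le> real (y (g i)) / real p" "real (y (g i)) / real p \<le> 1"
      using that gI(1)[of i] by (auto simp: divide_simps)
    then have "0 \<le> 2 * B * (real (y (g i)) / real p)" "2 * B * (real (y (g i)) / real p) \<le> 2 * B * 1"
      using B by (simp, intro mult_left_mono) auto
    then show ?thesis unfolding pt_def by linarith
  qed
  have lab0: "f (pt p y) (h k) \<ge> pt p y (h k)"
    if "\<forall>k<d. y k \<le> p" "p > 0" "k < d" "lab p y k = 0" for p y k
    using that by (auto simp: lab_def split: if_splits)
  have lab1: "f (pt p y) (h k) \<le> pt p y (h k)"
    if "\<forall>k<d. y k \<le> p" "p > 0" "k < d" "lab p y k = 1" for p y k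
  proof (cases "y k = p")
    case True
    then have "pt p y (h k) = B" using that by (simp add: pt_def gh)
    moreover have "\<bar>f (pt p y) (h k)\<bar> \<le> B" using pt_box that hI by (intro range) auto
    ultimately show ?thesis by linarith
  next
    case False
    then show ?thesis using that by (auto simp: lab_def split: if_splits)
  qed
  have lab_bd: "lab p y k = 0" if "\<forall>k<d. y k \<le> p" "p > 0" "k < d" "y k = 0" for p y k
  proof -
    have "pt p y (h k) = - B" using that by (simp add: pt_def gh)
    moreover have "\<bar>f (pt p y) (h k)\<bar> \<le> B" using pt_box that hI by (intro range) auto
    ultimately show ?thesis using that by (auto simp: lab_def)
  qed
  \<comment> \<open>Kuhn's lemma yields, for each direction, two vertices of one small cube with
    different labels. They are swapped if necessary, so that \<open>u\<close> carries label 0 and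
    \<open>w\<close> label 1.\<close>
  have kuhn: "\<exists>q u w. (\<forall>k<d. q k < p) \<and> (\<forall>k<d. (\<forall>j<d. q j \<le> u k j \<and> u k j \<le> q j + 1) \<and>
      (\<forall>j<d. q j \<le> w k j \<and> w k j \<le> q j + 1) \<and> lab p (u k) k = 0 \<and> lab p (w k) k = 1)"
    if p: "p > 0" for p
  proof -
    obtain q where q: "\<forall>i<d. q i < p" "\<forall>i<d. \<exists>r s. (\<forall>j<d. q j \<le> r j \<and> r j \<le> q j + 1) \<and>
        (\<forall>j<d. q j \<le> s j \<and> s j \<le> q j + 1) \<and> lab p r i \<noteq> lab p s i"
      by (rule kuhn_lemma[of p d "lab p"]) (use p lab_bd in \<open>auto simp: lab_def\<close>)
    have "\<forall>i. \<exists>r s. i < d \<longrightarrow> (\<forall>j<d. q j \<le> r j \<and> r j \<le> q j + 1) \<and>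
        (\<forall>j<d. q j \<le> s j \<and> s j \<le> q j + 1) \<and> lab p r i = 0 \<and> lab p s i = 1"
    proof
      fix i show "\<exists>r s. i < d \<longrightarrow> (\<forall>j<d. q j \<le> r j \<and> r j \<le> q j + 1) \<and>
        (\<forall>j<d. q j \<le> s j \<and> s j \<le> q j + 1) \<and> lab p r i = 0 \<and> lab p s i = 1"
      proof (cases "i < d")
        case True
        then obtain r s where rs: "\<forall>j<d. q j \<le> r j \<and> r j \<le> q j + 1"
          "\<forall>j<d. q j \<le> s j \<and> s j \<le> q j + 1" "lab p r i \<noteq> lab p s i" using q(2) by blast
        have "lab p r i = 0 \<and> lab p s i = 1 \<or> lab p r i = 1 \<and> lab p s i = 0"
          using rs(3) by (auto simp: lab_def split: if_splits)
        with rs(1,2) show ?thesis by blast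
      qed auto
    qed
    then obtain u w where "\<forall>i<d. (\<forall>j<d. q j \<le> u i j \<and> u i j \<le> q j + 1) \<and>
        (\<forall>j<d. q j \<le> w i j \<and> w i j \<le> q j + 1) \<and> lab p (u i) i = 0 \<and> lab p (w i) i = 1" by metis
    with q(1) show ?thesis by blast
  qed
  define P where "P n q u w \<longleftrightarrow> (\<forall>k<d. q k < Suc n) \<and> (\<forall>k<d. (\<forall>j<d. q j \<le> u k j \<and> u k j \<le> q j + 1) \<and>
      (\<forall>j<d. q j \<le> w k j \<and> w k j \<le> q j + 1) \<and> lab (Suc n) (u k) k = 0 \<and> lab (Suc n) (w k) k = 1)"
    for n q u w
  have "\<exists>q u w. P n q u w" for n
    unfolding P_def by (rule kuhn) simp
  then obtain q u w where "\<And>n. P n (q n) (u n) (w n)" by metis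
  then have q: "\<And>n k. k < d \<Longrightarrow> q n k < Suc n"
    and u: "\<And>n k j. \<lbrakk>k < d; j < d\<rbrakk> \<Longrightarrow> q n j \<le> u n k j \<and> u n k j \<le> q n j + 1"
    and w: "\<And>n k j. \<lbrakk>k < d; j < d\<rbrakk> \<Longrightarrow> q n j \<le> w n k j \<and> w n k j \<le> q n j + 1"
    and labu: "\<And>n k. k < d \<Longrightarrow> lab (Suc n) (u n k) k = 0"
    and labw: "\<And>n k. k < d \<Longrightarrow> lab (Suc n) (w n k) k = 1"
    unfolding P_def by blast+
  obtain r l where r: "strict_mono r" and l: "\<And>i. i \<in> I \<Longrightarrow> l i \<in> {-B..B}"
    and lim: "\<And>i. i \<in> I \<Longrightarrow> (\<lambda>n. pt (Suc (r n)) (q (r n)) i) \<longlonglongrightarrow> l i"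
  proof (rule finite_family_convergent_subsequence[of I "\<lambda>_. {-B..B}" "\<lambda>n. pt (Suc n) (q n)"])
    fix n i assume "i \<in> I"
    then show "pt (Suc n) (q n) i \<in> {-B..B}"
      using pt_box[of "q n" "Suc n" i] q[of _ n] by (fastforce intro: less_imp_le)
  qed (use fin in auto)
  \<comment> \<open>Vertices of the cube at \<open>q\<close> differ from its corner by at most the
    mesh in each coordinate, so all of them shrink to the same limit \<open>l\<close>.\<close>
  have near: "(\<lambda>n. pt (Suc (r n)) (y (r n)) i) \<longlonglongrightarrow> l i"
    if "i \<in> I" and y: "\<And>n j. j < d \<Longrightarrow> q n j \<le> y n j \<and> y n j \<le> q n j + 1" for y i
  proof -
    have null: "(\<lambda>n. 2 * B / real (Suc (r n))) \<longlonglongrightarrow> 0"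
      using LIMSEQ_subseq_LIMSEQ[OF lim_const_over_n[of "2*B", THEN LIMSEQ_Suc] r] by (simp add: o_def)
    have bound: "norm (pt (Suc (r n)) (y (r n)) i - pt (Suc (r n)) (q (r n)) i) \<le> 2 * B / real (Suc (r n))"
      for n
    proof -
      have "\<bar>real (y (r n) (g i)) - real (q (r n) (g i))\<bar> \<le> 1"
        using y[OF gI(1)[OF that(1)], of "r n"] by auto
      then have "2 * B / real (Suc (r n)) * \<bar>real (y (r n) (g i)) - real (q (r n) (g i))\<bar> \<le>
          2 * B / real (Suc (r n)) * 1"
        using B by (intro mult_left_mono) auto
      moreover have "pt (Suc (r n)) (y (r n)) i - pt (Suc (r n)) (q (r n)) i =
        2 * B / real (Suc (r n)) * (real (y (r n) (g i)) - real (q (r n) (g i)))"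
        by (simp add: pt_def right_diff_distrib diff_divide_distrib)
      ultimately show ?thesis using B by (simp only: real_norm_def abs_mult) simp
    qed
    have "(\<lambda>n. pt (Suc (r n)) (y (r n)) i - pt (Suc (r n)) (q (r n)) i) \<longlonglongrightarrow> 0"
      by (rule Lim_null_comparison[OF always_eventually[OF allI] null], rule bound)
    from tendsto_add[OF this lim[OF that(1)]] show ?thesis by simp
  qed
  have le: "q n j + 1 \<le> Suc n" if "j < d" for n j using q[OF that, of n] by simp
  \<comment> \<open>The vertices labelled 0 give \<open>l i \<le> f l i\<close> in the limit, those
    labelled 1 the reverse inequality.\<close>
  have "f l i = l i" if i: "i \<in> I" for i
  proof -
    define k where "k = g i"
    have k: "k < d" "h k = i" using gI[OF i] by (auto simp: k_def)
    have ule: "\<forall>j<d. u n k j \<le> Suc n" and wle: "\<forall>j<d. w n k j \<le> Suc n" for n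
      using u[OF k(1), of _ n] w[OF k(1), of _ n] le[of _ n] order_trans by blast+
    have "(\<lambda>n. f (pt (Suc (r n)) (u (r n) k)) i) \<longlonglongrightarrow> f l i"
      using pt_box[OF ule] by (intro cont near u i k) auto
    moreover have "(\<lambda>n. pt (Suc (r n)) (u (r n) k) i) \<longlonglongrightarrow> l i"
      by (rule near[OF i u[OF k(1)]])
    moreover have "pt (Suc (r n)) (u (r n) k) i \<le> f (pt (Suc (r n)) (u (r n) k)) i" for n
      using lab0[OF ule _ k(1) labu[OF k(1)]] k by simp
    ultimately have 1: "l i \<le> f l i" by (meson LIMSEQ_le)
    have "(\<lambda>n. f (pt (Suc (r n)) (w (r n) k)) i) \<longlonglongrightarrow> f l i"
      using pt_box[OF wle] by (intro cont near w i k) auto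
    moreover have "(\<lambda>n. pt (Suc (r n)) (w (r n) k) i) \<longlonglongrightarrow> l i"
      by (rule near[OF i w[OF k(1)]])
    moreover have "f (pt (Suc (r n)) (w (r n) k)) i \<le> pt (Suc (r n)) (w (r n) k) i" for n
      using lab1[OF wle _ k(1) labw[OF k(1)]] k by simp
    ultimately have "f l i \<le> l i" by (meson LIMSEQ_le)
    with 1 show ?thesis by simp
  qed
  moreover have "\<bar>l i\<bar> \<le> B" if "i \<in> I" for i using l[OF that] by auto
  ultimately show thesis using that by blast
qed

section \<open>Linear relations and Caratheodory's theorem\<close>

lemma homogeneous_system_nontrivial_solution:
  fixes M :: "'i \<Rightarrow> 'a \<Rightarrow> real"
  assumes "finite I" "finite S" "card I < card S"
  shows "\<exists>c. (\<exists>a\<in>S. c a \<noteq> 0) \<and> (\<forall>i\<in>I. (\<Sum>a\<in>S. c a * M i a) = 0)"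
  using assms
proof (induction I arbitrary: S M rule: finite_induct)
  case empty
  then have "S \<noteq> {}" by auto
  then show ?case by (intro exI[of _ "\<lambda>_. 1"]) auto
next
  case (insert j I)
  show ?case
  proof (cases "\<forall>a\<in>S. M j a = 0")
    case True
    have "card I < card S" using insert by simp
    from insert.IH[OF insert.prems(1) this, of M] obtain c where
      "\<exists>a\<in>S. c a \<noteq> 0" "\<forall>i\<in>I. (\<Sum>a\<in>S. c a * M i a) = 0" by blast
    then show ?thesis using True by (intro exI[of _ c]) auto
  next
    case False
    then obtain p where p: "p \<in> S" "M j p \<noteq> 0" by blast
    \<comment> \<open>Gaussian elimination: equation \<open>j\<close> is solved for the unknown at
      the pivot \<open>p\<close> and substituted into the others, leaving one equation and one
      unknown fewer.\<close>
    define M' where "M' i a = M i a - M i p * M j a / M j p" for i a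
    have "card I < card (S - {p})" using insert p by simp
    from insert.IH[OF _ this, of M'] insert.prems obtain c where
      c: "\<exists>a\<in>S - {p}. c a \<noteq> 0" "\<forall>i\<in>I. (\<Sum>a\<in>S - {p}. c a * M' i a) = 0" by auto
    \<comment> \<open>The value at the pivot that equation \<open>j\<close> forces.\<close>
    define t where "t = - (\<Sum>a\<in>S - {p}. c a * M j a) / M j p"
    define c' where "c' = c(p := t)"
    have split: "(\<Sum>a\<in>S. c' a * M i a) = t * M i p + (\<Sum>a\<in>S - {p}. c a * M i a)" for i
      using p insert.prems by (simp add: sum.remove[of S p] c'_def)
    have "(\<Sum>a\<in>S. c' a * M j a) = 0" using p by (simp add: split t_def)
    moreover have "(\<Sum>a\<in>S. c' a * M i a) = 0" if "i \<in> I" for i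
    proof -
      have "0 = (\<Sum>a\<in>S - {p}. c a * M i a - (M i p / M j p) * (c a * M j a))"
        using c(2) that by (simp add: M'_def algebra_simps)
      also have "\<dots> = (\<Sum>a\<in>S - {p}. c a * M i a) - (M i p / M j p) * (\<Sum>a\<in>S - {p}. c a * M j a)"
        by (simp only: sum_subtractf sum_distrib_left)
      finally show ?thesis by (simp add: split t_def)
    qed
    moreover have "\<exists>a\<in>S. c' a \<noteq> 0" using c(1) by (auto simp: c'_def)
    ultimately show ?thesis by (intro exI[of _ c']) auto
  qed
qed

text \<open>More than \<open>card I + 1\<close> atoms admit a nontrivial linear relation among the
  vectors (1, \<phi> a). Moving the weights along this relation changes neither the total mass nor
  the moments, and one moves until some weight vanishes.\<close>

lemma caratheodory_reduction:
  fixes \<phi> :: "'a \<Rightarrow> 'i \<Rightarrow> real"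
  assumes I: "finite I" and S: "finite S" and pos: "\<And>a. a \<in> S \<Longrightarrow> \<pi> a > 0" and one: "sum \<pi> S = 1"
  shows "\<exists>S' \<pi>'. S' \<subseteq> S \<and> card S' \<le> Suc (card I) \<and> (\<forall>a\<in>S'. \<pi>' a > (0::real)) \<and> sum \<pi>' S' = 1 \<and>
    (\<forall>i\<in>I. (\<Sum>a\<in>S'. \<pi>' a * \<phi> a i) = (\<Sum>a\<in>S. \<pi> a * \<phi> a i))"
  using S pos one
proof (induction "card S" arbitrary: S \<pi> rule: less_induct)
  case less
  show ?case
  proof (cases "card S \<le> Suc (card I)")
    case True
    then show ?thesis using less.prems by (intro exI[of _ S] exI[of _ \<pi>]) auto
  next
    case False
    \<comment> \<open>The extra row \<open>None\<close> consists of ones and encodes conservation of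
      total mass.\<close>
    define M where "M z a = (case z of None \<Rightarrow> 1 | Some i \<Rightarrow> \<phi> a i)" for z a
    have "card (insert None (Some ` I)) < card S"
      using False I by (simp add: card_image)
    from homogeneous_system_nontrivial_solution[OF _ less.prems(1) this, of M] I obtain c where
      c: "\<exists>a\<in>S. c a \<noteq> 0" "(\<Sum>a\<in>S. c a) = 0" "\<And>i. i \<in> I \<Longrightarrow> (\<Sum>a\<in>S. c a * \<phi> a i) = 0"
      by (auto simp: M_def)
    have "\<exists>a\<in>S. c a > 0"
    proof (rule ccontr)
      assume "\<not> ?thesis"
      then have "\<forall>a\<in>S. c a \<le> 0" by auto
      then have "\<forall>a\<in>S. c a = 0" using c(2) less.prems(1) sum_nonneg_eq_0_iff[of S "\<lambda>a. - c a"]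
        by (simp add: sum_negf)
      with c(1) show False by blast
    qed
    then have ne: "{a\<in>S. c a > 0} \<noteq> {}" by blast
    \<comment> \<open>The longest step that keeps all weights nonnegative; the atom \<open>p\<close>
      attaining the minimum is dropped.\<close>
    define t where "t = Min ((\<lambda>a. \<pi> a / c a) ` {a\<in>S. c a > 0})"
    have fin: "finite {a\<in>S. c a > 0}" using less.prems by auto
    obtain p where p: "p \<in> S" "c p > 0" "t = \<pi> p / c p"
      using Min_in[OF finite_imageI[OF fin], of "\<lambda>a. \<pi> a / c a"] ne unfolding t_def by blast
    have t: "t \<ge> 0" using p less.prems(2)[of p] by auto
    have nn: "\<pi> a - t * c a \<ge> 0" if "a \<in> S" for a
    proof (cases "c a > 0")
      case True
      then have "t \<le> \<pi> a / c a" unfolding t_def using that fin by (intro Min_le) auto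
      then show ?thesis using True by (simp add: field_simps)
    next
      case False
      then have "t * c a \<le> 0" using t by (simp add: mult_nonneg_nonpos)
      then show ?thesis using less.prems(2)[OF that] by linarith
    qed
    define \<pi>' where "\<pi>' a = \<pi> a - t * c a" for a
    define S' where "S' = {a\<in>S. \<pi>' a > 0}"
    have sum': "(\<Sum>a\<in>S'. \<pi>' a * \<psi> a) = (\<Sum>a\<in>S. \<pi>' a * \<psi> a)" for \<psi>
      using nn by (intro sum.mono_neutral_left less.prems) (auto simp: S'_def \<pi>'_def antisym_conv2)
    have "p \<notin> S'" using p by (simp add: S'_def \<pi>'_def)
    then have "S' \<subset> S" using p by (auto simp: S'_def)
    then have "card S' < card S" using less.prems by (simp add: psubset_card_mono)
    moreover have "sum \<pi>' S' = 1"
      using sum'[of "\<lambda>_. 1"] c(2) less.prems by (simp add: \<pi>'_def sum_subtractf sum_distrib_left[symmetric])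
    moreover have "finite S'" "\<And>a. a \<in> S' \<Longrightarrow> \<pi>' a > 0" using less.prems(1) by (auto simp: S'_def)
    ultimately obtain S'' \<pi>'' where *: "S'' \<subseteq> S'" "card S'' \<le> Suc (card I)" "\<forall>a\<in>S''. \<pi>'' a > 0"
      "sum \<pi>'' S'' = 1" "\<forall>i\<in>I. (\<Sum>a\<in>S''. \<pi>'' a * \<phi> a i) = (\<Sum>a\<in>S'. \<pi>' a * \<phi> a i)"
      using less.hyps[of S' \<pi>'] by blast
    have "(\<Sum>a\<in>S'. \<pi>' a * \<phi> a i) = (\<Sum>a\<in>S. \<pi> a * \<phi> a i)" if "i \<in> I" for i
      using c(3)[OF that] sum'[of "\<lambda>a. \<phi> a i"]
      by (simp add: \<pi>'_def algebra_simps sum_subtractf sum_distrib_left[symmetric])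
    then show ?thesis
      using * \<open>S' \<subset> S\<close> by (intro exI[of _ S''] exI[of _ \<pi>'']) auto
  qed
qed

text \<open>The number of slots is exactly \<open>card I + 1\<close>, whatever the set of atoms:
  missing slots repeat some atom with weight 0. Lists found for different tolerances can therefore
  be compared slot by slot. Every slot, padding included, keeps an atom charged by
  \<open>\<pi>\<close>, and this is what carries approximate optimality.\<close>

lemma caratheodory_indexed:
  fixes \<phi> :: "'a \<Rightarrow> 'i \<Rightarrow> real"
  assumes I: "finite I" and S: "finite S" and nn: "\<And>a. a \<in> S \<Longrightarrow> \<pi> a \<ge> 0" and one: "sum \<pi> S = 1"
  obtains a w where "\<And>l. l \<le> card I \<Longrightarrow> a l \<in> S \<and> \<pi> (a l) > 0" "\<And>l. l \<le> card I \<Longrightarrow> w l \<ge> (0::real)"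
    "(\<Sum>l\<le>card I. w l) = 1"
    "\<And>i. i \<in> I \<Longrightarrow> (\<Sum>l\<le>card I. w l * \<phi> (a l) i) = (\<Sum>b\<in>S. \<pi> b * \<phi> b i)"
proof -
  let ?S = "{a\<in>S. \<pi> a > 0}"
  have sum0: "(\<Sum>a\<in>?S. \<pi> a * \<psi> a) = (\<Sum>a\<in>S. \<pi> a * \<psi> a)" for \<psi>
    using nn by (intro sum.mono_neutral_left S) (auto simp: antisym_conv2)
  have finS: "finite ?S" and pos: "\<And>a. a \<in> ?S \<Longrightarrow> \<pi> a > 0" using S by auto
  have "sum \<pi> ?S = 1" using sum0[of "\<lambda>_. 1"] one by simp
  then obtain S' \<pi>' where S': "S' \<subseteq> ?S" "card S' \<le> Suc (card I)" "\<forall>a\<in>S'. \<pi>' a > 0"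
    "sum \<pi>' S' = 1" "\<forall>i\<in>I. (\<Sum>a\<in>S'. \<pi>' a * \<phi> a i) = (\<Sum>a\<in>?S. \<pi> a * \<phi> a i)"
    using caratheodory_reduction[where \<pi> = \<pi> and \<phi> = \<phi>, OF I finS pos] by blast
  have finS': "finite S'" using S' S finite_subset by fastforce
  obtain h where h: "bij_betw h {0..<card S'} S'" using ex_bij_betw_nat_finite[OF finS'] by blast
  have "S' \<noteq> {}" using S'(4) by auto
  then obtain a0 where a0: "a0 \<in> S'" by blast
  define a where "a l = (if l < card S' then h l else a0)" for l
  define w where "w l = (if l < card S' then \<pi>' (h l) else 0)" for l
  have sub: "{0..<card S'} \<subseteq> {..card I}" using S'(2) by auto
  have hS: "h l \<in> S'" if "l < card S'" for l using h that by (auto simp: bij_betw_def)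
  have aS: "a l \<in> S'" for l using hS a0 by (auto simp: a_def)
  have sumw: "(\<Sum>l\<le>card I. w l * \<psi> (a l)) = (\<Sum>b\<in>S'. \<pi>' b * \<psi> b)" for \<psi>
  proof -
    have "(\<Sum>l\<le>card I. w l * \<psi> (a l)) = (\<Sum>l\<in>{0..<card S'}. \<pi>' (h l) * \<psi> (h l))"
      using sub by (intro sum.mono_neutral_cong_right) (auto simp: w_def a_def)
    then show ?thesis using sum.reindex_bij_betw[OF h, of "\<lambda>b. \<pi>' b * \<psi> b"] by simp
  qed
  show thesis
  proof (rule that[of a w])
    show "a l \<in> S \<and> \<pi> (a l) > 0" for l using aS[of l] S' by auto
    show "w l \<ge> 0" for l using S'(3) hS by (auto simp: w_def less_imp_le)
    show "(\<Sum>l\<le>card I. w l) = 1" using sumw[of "\<lambda>_. 1"] S'(4) by simp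
    show "(\<Sum>l\<le>card I. w l * \<phi> (a l) i) = (\<Sum>b\<in>S. \<pi> b * \<phi> b i)" if "i \<in> I" for i
      using sumw[of "\<lambda>b. \<phi> b i"] S'(5) that sum0[of "\<lambda>b. \<phi> b i"] by simp
  qed
qed

section \<open>Finite-range mean field games\<close>

text \<open>The weights are total functions vanishing off \<open>J\<close>, so they are also weights
  on the infinite grid, and limits can be taken at every index.\<close>

definition simplex_on :: "'j set \<Rightarrow> ('j \<Rightarrow> real) set" where
  "simplex_on J = {z. (\<forall>j. 0 \<le> z j) \<and> (\<forall>j. j \<notin> J \<longrightarrow> z j = 0) \<and> sum z J = 1}"

lemma simplex_onD:
  assumes "z \<in> simplex_on J"
  shows "0 \<le> z j" "j \<notin> J \<Longrightarrow> z j = 0" "sum z J = 1"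
  using assms by (auto simp: simplex_on_def)

lemma simplex_on_le_1:
  assumes "finite J" "z \<in> simplex_on J"
  shows "z j \<le> 1"
proof (cases "j \<in> J")
  case True
  then have "z j \<le> sum z J" using assms simplex_onD(1)[OF assms(2)] by (intro member_le_sum) auto
  then show ?thesis using simplex_onD(3)[OF assms(2)] by simp
qed (use simplex_onD(2)[OF assms(2)] in simp)

lemma simplex_on_limit:
  assumes "\<And>n. Z n \<in> simplex_on J" "\<And>j. (\<lambda>n. Z n j) \<longlonglongrightarrow> z j"
  shows "z \<in> simplex_on J"
proof -
  have "0 \<le> z j" for j
    using assms(2)[of j] simplex_onD(1)[OF assms(1)] by (meson LIMSEQ_le_const)
  moreover have "z j = 0" if "j \<notin> J" for j
    using assms(2)[of j] simplex_onD(2)[OF assms(1) that] by (simp add: LIMSEQ_const_iff)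
  moreover have "(\<lambda>n. sum (Z n) J) \<longlonglongrightarrow> sum z J" by (intro tendsto_sum assms)
  then have "sum z J = 1" using simplex_onD(3)[OF assms(1)] by (simp add: LIMSEQ_const_iff)
  ultimately show ?thesis by (auto simp: simplex_on_def)
qed

text \<open>Abstract form of the scheme: \<open>K\<close> holds the admissible actions,
  \<open>\<beta> j a\<close> is the distribution of the next node after action \<open>a\<close> at
  node \<open>j\<close>, supported in the finite set \<open>S j\<close>, \<open>ell\<close> is the
  running cost, and \<open>f\<close>, \<open>g\<close> are the couplings. Boundedness and continuity
  of the couplings are asked only for weights with a common finite support.\<close>

locale finite_range_mfg =
  fixes K :: "'a::metric_space set" and \<beta> :: "'j \<Rightarrow> 'a \<Rightarrow> 'j \<Rightarrow> real" and S :: "'j \<Rightarrow> 'j set"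
    and ell :: "'j \<Rightarrow> 'a \<Rightarrow> real" and f g :: "'j \<Rightarrow> ('j \<Rightarrow> real) \<Rightarrow> real"
    and z0 :: "'j \<Rightarrow> real" and J0 :: "'j set" and N :: nat and C :: real
  assumes K: "compact K" "K \<noteq> {}"
    and S: "finite (S j)"
    and \<beta>_nonneg: "0 \<le> \<beta> j a i"
    and \<beta>_zero: "\<lbrakk>a \<in> K; i \<notin> S j\<rbrakk> \<Longrightarrow> \<beta> j a i = 0"
    and \<beta>_sum: "a \<in> K \<Longrightarrow> (\<Sum>i\<in>S j. \<beta> j a i) = 1"
    and \<beta>_cont: "continuous_on K (\<lambda>a. \<beta> j a i)"
    and ell_cont: "continuous_on K (ell j)"
    and ell_bound: "a \<in> K \<Longrightarrow> \<bar>ell j a\<bar> \<le> C"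
    and f_bound: "\<lbrakk>finite J; z \<in> simplex_on J\<rbrakk> \<Longrightarrow> \<bar>f i z\<bar> \<le> C"
    and g_bound: "\<lbrakk>finite J; z \<in> simplex_on J\<rbrakk> \<Longrightarrow> \<bar>g i z\<bar> \<le> C"
    and f_cont: "\<lbrakk>finite J; \<And>n. Z n \<in> simplex_on J; z \<in> simplex_on J; \<And>j. (\<lambda>n. Z n j) \<longlonglongrightarrow> z j\<rbrakk>
      \<Longrightarrow> (\<lambda>n. f i (Z n)) \<longlonglongrightarrow> f i z"
    and g_cont: "\<lbrakk>finite J; \<And>n. Z n \<in> simplex_on J; z \<in> simplex_on J; \<And>j. (\<lambda>n. Z n j) \<longlonglongrightarrow> z j\<rbrakk>
      \<Longrightarrow> (\<lambda>n. g i (Z n)) \<longlonglongrightarrow> g i z"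
    and J0: "finite J0"
    and z0: "z0 \<in> simplex_on J0"
begin

section \<open>One-step costs, minimal values and the smoothed choice of actions\<close>

definition Q :: "('j \<Rightarrow> real) \<Rightarrow> 'j \<Rightarrow> 'a \<Rightarrow> real" where
  "Q u j a = (\<Sum>i\<in>S j. u i * \<beta> j a i) + ell j a"

text \<open>The action set is a parameter because the value function minimises over
  \<open>K\<close>, whereas the smoothed choice refers to a finite net.\<close>

definition val :: "'a set \<Rightarrow> ('j \<Rightarrow> real) \<Rightarrow> 'j \<Rightarrow> real" where
  "val A u j = (INF a\<in>A. Q u j a)"

lemma \<beta>_le_1: "a \<in> K \<Longrightarrow> \<beta> j a i \<le> 1"
  using member_le_sum[of i "S j" "\<beta> j a"] \<beta>_nonneg \<beta>_sum[of a j] \<beta>_zero[of a i j] S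
  by (cases "i \<in> S j") auto

lemma Q_cong: "(\<And>i. i \<in> S j \<Longrightarrow> u i = u' i) \<Longrightarrow> Q u j = Q u' j"
  by (auto simp: Q_def fun_eq_iff)

lemma continuous_on_Q: "continuous_on K (Q u j)"
  unfolding Q_def[abs_def] by (intro continuous_intros \<beta>_cont ell_cont)

lemma Q_tendsto:
  assumes "\<And>i. i \<in> S j \<Longrightarrow> (\<lambda>n. U n i) \<longlonglongrightarrow> u i" "\<And>n. a n \<in> K" "b \<in> K" "a \<longlonglongrightarrow> b"
  shows "(\<lambda>n. Q (U n) j (a n)) \<longlonglongrightarrow> Q u j b"
proof -
  have *: "(\<lambda>n. h (a n)) \<longlonglongrightarrow> h b" if "continuous_on K h" for h :: "'a \<Rightarrow> real"
    by (rule continuous_on_tendsto_compose[OF that assms(4,3)]) (simp add: assms(2))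
  show ?thesis unfolding Q_def
    by (intro tendsto_add tendsto_sum tendsto_mult assms(1) *[OF \<beta>_cont] *[OF ell_cont])
qed

text \<open>Each transition weight lies in [0,1]. The bound is uniform in the action and hence
  passes to the infimum in \<open>val\<close>.\<close>

lemma Q_diff_le:
  assumes "a \<in> K"
  shows "\<bar>Q u j a - Q u' j a\<bar> \<le> (\<Sum>i\<in>S j. \<bar>u i - u' i\<bar>)"
proof -
  have "Q u j a - Q u' j a = (\<Sum>i\<in>S j. (u i - u' i) * \<beta> j a i)"
    by (simp add: Q_def sum_subtractf left_diff_distrib)
  also have "\<bar>\<dots>\<bar> \<le> (\<Sum>i\<in>S j. \<bar>(u i - u' i) * \<beta> j a i\<bar>)" by (rule sum_abs)
  also have "\<dots> \<le> (\<Sum>i\<in>S j. \<bar>u i - u' i\<bar>)"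
    using \<beta>_nonneg \<beta>_le_1[OF assms] by (intro sum_mono) (simp add: abs_mult mult_left_le)
  finally show ?thesis .
qed

lemma Q_bound:
  assumes "a \<in> K" "\<And>i. i \<in> S j \<Longrightarrow> \<bar>u i\<bar> \<le> B"
  shows "\<bar>Q u j a\<bar> \<le> B + C"
proof -
  have "\<bar>\<Sum>i\<in>S j. u i * \<beta> j a i\<bar> \<le> (\<Sum>i\<in>S j. \<bar>u i * \<beta> j a i\<bar>)" by (rule sum_abs)
  also have "\<dots> \<le> (\<Sum>i\<in>S j. B * \<beta> j a i)"
    using \<beta>_nonneg assms by (intro sum_mono) (simp add: abs_mult mult_right_mono)
  also have "\<dots> = B" using \<beta>_sum[OF assms(1)] by (simp add: sum_distrib_left[symmetric])
  finally show ?thesis unfolding Q_def using ell_bound[OF assms(1), of j] by linarith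
qed

context
  fixes A assumes A: "compact A" "A \<noteq> {}" "A \<subseteq> K"
begin

lemma val_attained: "\<exists>a\<in>A. Q u j a = val A u j \<and> (\<forall>b\<in>A. Q u j a \<le> Q u j b)"
proof -
  obtain a where a: "a \<in> A" "\<forall>b\<in>A. Q u j a \<le> Q u j b"
    using continuous_attains_inf[OF A(1,2) continuous_on_subset[OF continuous_on_Q A(3)]] by blast
  then have "val A u j = Q u j a"
    unfolding val_def by (intro cInf_eq_minimum) auto
  with a show ?thesis by auto
qed

lemma val_le: "a \<in> A \<Longrightarrow> val A u j \<le> Q u j a"
  using val_attained[of u j] by auto

lemma val_diff_le: "\<bar>val A u j - val A u' j\<bar> \<le> (\<Sum>i\<in>S j. \<bar>u i - u' i\<bar>)"
proof -
  have "val A u j \<le> val A u' j + (\<Sum>i\<in>S j. \<bar>u i - u' i\<bar>)" for u u'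
  proof -
    obtain a where a: "a \<in> A" "Q u' j a = val A u' j" using val_attained by blast
    then have "val A u j \<le> Q u j a" by (intro val_le)
    also have "\<dots> \<le> Q u' j a + (\<Sum>i\<in>S j. \<bar>u i - u' i\<bar>)"
      using Q_diff_le[of a u j u'] a A by force
    finally show ?thesis using a by simp
  qed
  from this[of u u'] this[of u' u] show ?thesis by (simp add: abs_minus_commute abs_diff_le_iff)
qed

lemma val_cong: "(\<And>i. i \<in> S j \<Longrightarrow> u i = u' i) \<Longrightarrow> val A u j = val A u' j"
  unfolding val_def using Q_cong[of j u u'] by simp

lemma val_tendsto:
  assumes "\<And>i. i \<in> S j \<Longrightarrow> (\<lambda>n. U n i) \<longlonglongrightarrow> u i"
  shows "(\<lambda>n. val A (U n) j) \<longlonglongrightarrow> val A u j"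
proof -
  have "(\<lambda>n. \<Sum>i\<in>S j. \<bar>U n i - u i\<bar>) \<longlonglongrightarrow> (\<Sum>i\<in>S j. \<bar>u i - u i\<bar>)"
    by (intro tendsto_intros assms)
  then have null: "(\<lambda>n. \<Sum>i\<in>S j. \<bar>U n i - u i\<bar>) \<longlonglongrightarrow> 0" by simp
  have "(\<lambda>n. val A (U n) j - val A u j) \<longlonglongrightarrow> 0"
    by (rule Lim_null_comparison[OF always_eventually[OF allI] null]) (simp add: val_diff_le)
  then show ?thesis by (simp add: LIM_zero_iff)
qed

lemma val_bound:
  assumes "\<And>i. i \<in> S j \<Longrightarrow> \<bar>u i\<bar> \<le> B"
  shows "\<bar>val A u j\<bar> \<le> B + C"
proof -
  obtain a where "a \<in> A" "Q u j a = val A u j" using val_attained by blast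
  then show ?thesis using Q_bound[of a j u B] assms A(3) by auto
qed

text \<open>Unlike the set of optimal actions, this probability vector depends continuously on \<open>u\<close>; it
  charges only \<open>e\<close>-optimal actions.\<close>
definition soft :: "real \<Rightarrow> ('j \<Rightarrow> real) \<Rightarrow> 'j \<Rightarrow> 'a \<Rightarrow> real" where
  "soft e u j a = max 0 (e + val A u j - Q u j a) / (\<Sum>b\<in>A. max 0 (e + val A u j - Q u j b))"

text \<open>A minimiser over \<open>A\<close> contributes the summand \<open>e\<close>, so the
  normalising constant in \<open>soft\<close> is positive.\<close>

lemma soft_sum_pos:
  assumes "finite A" "e > 0"
  shows "(\<Sum>b\<in>A. max 0 (e + val A u j - Q u j b)) > 0"
proof -
  obtain a where a: "a \<in> A" "Q u j a = val A u j" using val_attained by blast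
  then show ?thesis using assms by (intro sum_pos2[of _ a]) auto
qed

lemma soft_prob:
  assumes "finite A" "e > 0"
  shows "soft e u j a \<ge> 0" "(\<Sum>a\<in>A. soft e u j a) = 1"
    "soft e u j a > 0 \<Longrightarrow> Q u j a \<le> val A u j + e"
proof -
  note pos = soft_sum_pos[OF assms, of u j]
  show "soft e u j a \<ge> 0" unfolding soft_def using pos by simp
  show "(\<Sum>a\<in>A. soft e u j a) = 1" unfolding soft_def using pos by (simp add: sum_divide_distrib[symmetric])
  show "soft e u j a > 0 \<Longrightarrow> Q u j a \<le> val A u j + e"
    by (rule ccontr) (simp add: soft_def max_def split: if_splits)
qed

lemma soft_cong: "(\<And>i. i \<in> S j \<Longrightarrow> u i = u' i) \<Longrightarrow> soft e u j a = soft e u' j a"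
  unfolding soft_def using val_cong[of j u u'] Q_cong[of j u u'] by simp

lemma soft_tendsto:
  assumes "finite A" "e > 0" "a \<in> A" "\<And>i. i \<in> S j \<Longrightarrow> (\<lambda>n. U n i) \<longlonglongrightarrow> u i"
  shows "(\<lambda>n. soft e (U n) j a) \<longlonglongrightarrow> soft e u j a"
proof -
  have "(\<lambda>n. max 0 (e + val A (U n) j - Q (U n) j b)) \<longlonglongrightarrow> max 0 (e + val A u j - Q u j b)" if "b \<in> A" for b
    using that A(3)
    by (intro tendsto_max tendsto_diff tendsto_add tendsto_const val_tendsto Q_tendsto assms(4)) auto
  then show ?thesis unfolding soft_def
    using soft_sum_pos[OF assms(1,2), of u j] assms(3) by (intro tendsto_divide tendsto_sum) auto
qed

end

section \<open>Reachable nodes, mass transport and backward recursion\<close>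

primrec reach :: "nat \<Rightarrow> 'j set" where
  "reach 0 = J0"
| "reach (Suc k) = (\<Union>j\<in>reach k. S j)"

text \<open>\<open>reach\<close> collects whole stencils regardless of the controls, so the finite
  index set of the fixed-point problem is known before any control is chosen.\<close>

lemma finite_reach: "finite (reach k)"
  by (induction k) (auto simp: J0 S)

lemma transport_simplex:
  assumes z: "z \<in> simplex_on (reach k)"
    and nn: "\<And>j i. j \<in> reach k \<Longrightarrow> 0 \<le> \<gamma> j i"
    and zero: "\<And>j i. \<lbrakk>j \<in> reach k; i \<notin> S j\<rbrakk> \<Longrightarrow> \<gamma> j i = 0"
    and one: "\<And>j. j \<in> reach k \<Longrightarrow> (\<Sum>i\<in>S j. \<gamma> j i) = 1"
  shows "(\<lambda>i. \<Sum>j\<in>reach k. z j * \<gamma> j i) \<in> simplex_on (reach (Suc k))"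
proof -
  have "(\<Sum>i\<in>reach (Suc k). \<Sum>j\<in>reach k. z j * \<gamma> j i) = (\<Sum>j\<in>reach k. z j * (\<Sum>i\<in>reach (Suc k). \<gamma> j i))"
    by (subst sum.swap) (simp add: sum_distrib_left)
  also have "\<dots> = (\<Sum>j\<in>reach k. z j * 1)"
  proof (intro sum.cong refl arg_cong2[where f = times])
    fix j assume j: "j \<in> reach k"
    have "(\<Sum>i\<in>S j. \<gamma> j i) = (\<Sum>i\<in>reach (Suc k). \<gamma> j i)"
      using j zero by (intro sum.mono_neutral_left finite_reach) auto
    then show "(\<Sum>i\<in>reach (Suc k). \<gamma> j i) = 1" using one j by simp
  qed
  also have "\<dots> = 1" using simplex_onD(3)[OF z] by simp
  finally have "(\<Sum>i\<in>reach (Suc k). \<Sum>j\<in>reach k. z j * \<gamma> j i) = 1" .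
  moreover have "0 \<le> (\<Sum>j\<in>reach k. z j * \<gamma> j i)" for i
    using nn simplex_onD(1)[OF z] by (intro sum_nonneg mult_nonneg_nonneg) auto
  moreover have "(\<Sum>j\<in>reach k. z j * \<gamma> j i) = 0" if "i \<notin> reach (Suc k)" for i
    using zero that by (intro sum.neutral) auto
  ultimately show ?thesis unfolding simplex_on_def by blast
qed

text \<open>The recursion runs in time to go, r = N - k, hence the coupling at \<open>Suc r\<close>
  is taken at time \<open>N - Suc r\<close>. The minimum is always over all of \<open>K\<close>,
  even when the masses are moved by actions from a net.\<close>

primrec backward :: "(nat \<Rightarrow> 'j \<Rightarrow> real) \<Rightarrow> nat \<Rightarrow> 'j \<Rightarrow> real" where
  "backward m 0 = (\<lambda>j. g j (m N))"
| "backward m (Suc r) = (\<lambda>j. val K (backward m r) j + f j (m (N - Suc r)))"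

definition value_fun :: "(nat \<Rightarrow> 'j \<Rightarrow> real) \<Rightarrow> nat \<Rightarrow> 'j \<Rightarrow> real" where
  "value_fun m k = backward m (N - k)"

lemma value_fun_final: "value_fun m N j = g j (m N)"
  by (simp add: value_fun_def)

lemma value_fun_step: "k < N \<Longrightarrow> value_fun m k j = val K (value_fun m (Suc k)) j + f j (m k)"
proof -
  assume "k < N"
  then have "N - k = Suc (N - Suc k)" "N - (N - k) = k" by simp_all
  then show ?thesis by (simp add: value_fun_def)
qed

text \<open>One C comes from \<open>g\<close>, and each backward step adds two more, through
  \<open>ell\<close> and \<open>f\<close>. The constant becomes the half-width of the box in
  Brouwer's theorem.\<close>

lemma value_fun_bound:
  assumes m: "\<And>k. k \<le> N \<Longrightarrow> m k \<in> simplex_on (reach k)"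
  shows "\<bar>value_fun m k j\<bar> \<le> C * real (2 * N + 1)"
proof -
  have "\<bar>backward m r j\<bar> \<le> C * real (2 * r + 1)" for r j
  proof (induction r arbitrary: j)
    case 0
    then show ?case using g_bound[OF finite_reach m, of N] by simp
  next
    case (Suc r)
    have "\<bar>val K (backward m r) j\<bar> \<le> C * real (2 * r + 1) + C" using Suc by (intro val_bound K) auto
    moreover have "\<bar>f j (m (N - Suc r))\<bar> \<le> C" using f_bound[OF finite_reach m] by simp
    ultimately show ?case by (simp add: algebra_simps)
  qed
  from this[of "N - k" j] have "\<bar>value_fun m k j\<bar> \<le> C * real (2 * (N - k) + 1)" by (simp add: value_fun_def)
  moreover have "C \<ge> 0" using ell_bound K(2) abs_ge_zero order_trans by (metis ex_in_conv)
  then have "C * real (2 * (N - k) + 1) \<le> C * real (2 * N + 1)" by (intro mult_left_mono) auto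
  ultimately show ?thesis by linarith
qed

lemma value_fun_tendsto:
  assumes M: "\<And>n k. k \<le> N \<Longrightarrow> M n k \<in> simplex_on (reach k)"
    and m: "\<And>k. k \<le> N \<Longrightarrow> m k \<in> simplex_on (reach k)"
    and lim: "\<And>k j. k \<le> N \<Longrightarrow> (\<lambda>n. M n k j) \<longlonglongrightarrow> m k j"
  shows "(\<lambda>n. value_fun (M n) k j) \<longlonglongrightarrow> value_fun m k j"
proof -
  have "(\<lambda>n. backward (M n) r j) \<longlonglongrightarrow> backward m r j" for r j
  proof (induction r arbitrary: j)
    case 0
    show ?case unfolding backward.simps by (intro g_cont[OF finite_reach[of N]] M m lim) auto
  next
    case (Suc r)
    show ?case unfolding backward.simps
      by (intro tendsto_add val_tendsto K Suc f_cont[OF finite_reach[of "N - Suc r"]] M m lim) auto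
  qed
  then show ?thesis by (simp add: value_fun_def)
qed

text \<open>The unknown of the fixed-point problem is the vector of values \<open>u k j\<close> at the finitely many
  reachable nodes.\<close>
lemma approximate_equilibrium:
  assumes A: "finite A" "A \<noteq> {}" "A \<subseteq> K" and e: "e > 0"
  obtains m \<pi> where "m 0 = z0" "\<And>k. k \<le> N \<Longrightarrow> m k \<in> simplex_on (reach k)"
    "\<And>k j a. \<pi> k j a \<ge> (0::real)" "\<And>k j. (\<Sum>a\<in>A. \<pi> k j a) = 1"
    "\<And>k j a b. \<lbrakk>k < N; j \<in> reach k; a \<in> A; \<pi> k j a > 0; b \<in> A\<rbrakk>
      \<Longrightarrow> Q (value_fun m (Suc k)) j a \<le> Q (value_fun m (Suc k)) j b + e"
    "\<And>k i. k < N \<Longrightarrow> m (Suc k) i = (\<Sum>j\<in>reach k. m k j * (\<Sum>a\<in>A. \<pi> k j a * \<beta> j a i))"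
proof -
  note cA = finite_imp_compact[OF A(1)] A(2,3)
  note soft = soft_prob[OF cA A(1) e]
  \<comment> \<open>The choice at time k is governed by the values at time \<open>Suc k\<close>. The
    result lies in the simplex for every \<open>u\<close>, so the iteration needs no constraint on
    \<open>u\<close> beyond the box.\<close>
  define flow where "flow u = rec_nat z0 (\<lambda>k z i. \<Sum>j\<in>reach k. z j * (\<Sum>a\<in>A. soft A e (u (Suc k)) j a * \<beta> j a i))"
    for u :: "nat \<Rightarrow> 'j \<Rightarrow> real"
  have flow0: "flow u 0 = z0" for u by (simp add: flow_def)
  have flow_Suc: "flow u (Suc k) i =
    (\<Sum>j\<in>reach k. flow u k j * (\<Sum>a\<in>A. soft A e (u (Suc k)) j a * \<beta> j a i))" for u k i
    by (simp add: flow_def)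
  have flow_simplex: "flow u k \<in> simplex_on (reach k)" for u k
  proof (induction k)
    case (Suc k)
    have "(\<lambda>i. \<Sum>j\<in>reach k. flow u k j * (\<Sum>a\<in>A. soft A e (u (Suc k)) j a * \<beta> j a i)) \<in> simplex_on (reach (Suc k))"
    proof (rule transport_simplex[OF Suc])
      fix j
      show "0 \<le> (\<Sum>a\<in>A. soft A e (u (Suc k)) j a * \<beta> j a i)" for i
        by (intro sum_nonneg mult_nonneg_nonneg soft \<beta>_nonneg)
      show "(\<Sum>a\<in>A. soft A e (u (Suc k)) j a * \<beta> j a i) = 0" if "i \<notin> S j" for i
        using that A \<beta>_zero by (intro sum.neutral) auto
      have "(\<Sum>i\<in>S j. \<Sum>a\<in>A. soft A e (u (Suc k)) j a * \<beta> j a i) =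
          (\<Sum>a\<in>A. soft A e (u (Suc k)) j a * (\<Sum>i\<in>S j. \<beta> j a i))"
        by (subst sum.swap) (simp add: sum_distrib_left)
      also have "\<dots> = (\<Sum>a\<in>A. soft A e (u (Suc k)) j a * 1)"
        using A \<beta>_sum by (intro sum.cong refl) auto
      finally show "(\<Sum>i\<in>S j. \<Sum>a\<in>A. soft A e (u (Suc k)) j a * \<beta> j a i) = 1" using soft by simp
    qed
    then show ?case by (simp add: flow_Suc[abs_def])
  qed (simp add: flow0 z0)
  have flow_tendsto: "(\<lambda>n. flow (U n) k i) \<longlonglongrightarrow> flow u k i"
    if "\<And>k i. \<lbrakk>k \<le> N; i \<in> reach k\<rbrakk> \<Longrightarrow> (\<lambda>n. U n k i) \<longlonglongrightarrow> u k i" "k \<le> N" for U u k i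
    using that(2)
  proof (induction k arbitrary: i)
    case 0
    show ?case by (simp add: flow0)
  next
    case (Suc k)
    show ?case unfolding flow_Suc
      using Suc by (intro tendsto_intros soft_tendsto cA A e that(1)) auto
  qed
  define I where "I = (SIGMA k:{..N}. reach k)"
  \<comment> \<open>\<open>\<Phi> x\<close> reads \<open>x\<close> only on \<open>I\<close>, because
    stencils of reachable nodes lie in the next reachable set. Convergence on \<open>I\<close>
    therefore suffices for its continuity.\<close>
  define \<Phi> where "\<Phi> x = (\<lambda>(k, j). value_fun (flow (\<lambda>k j. x (k, j))) k j)" for x :: "nat \<times> 'j \<Rightarrow> real"
  have "C \<ge> 0" using ell_bound K(2) abs_ge_zero order_trans by (metis ex_in_conv)
  obtain x where "\<And>p. p \<in> I \<Longrightarrow> \<Phi> x p = x p"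
  proof (rule brouwer_box[of I "C * real (2 * N + 1)" \<Phi>])
    show "finite I" unfolding I_def using finite_reach by auto
    show "0 \<le> C * real (2 * N + 1)" using \<open>C \<ge> 0\<close> by simp
    show "\<bar>\<Phi> x p\<bar> \<le> C * real (2 * N + 1)" for x p
      unfolding \<Phi>_def by (cases p) (simp only: prod.case, intro value_fun_bound flow_simplex)
    show "(\<lambda>n. \<Phi> (X n) p) \<longlonglongrightarrow> \<Phi> x p"
      if "\<And>i. i \<in> I \<Longrightarrow> (\<lambda>n. X n i) \<longlonglongrightarrow> x i" for X x p
      unfolding \<Phi>_def
      by (cases p) (simp only: prod.case, intro value_fun_tendsto flow_simplex flow_tendsto that,
        auto simp: I_def)
  qed auto
  note x = this
  define u where "u k j = x (k, j)" for k j
  define m where "m = flow u"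
  have u: "value_fun m k j = u k j" if "k \<le> N" "j \<in> reach k" for k j
    using x[of "(k, j)"] that by (simp add: I_def \<Phi>_def m_def u_def[abs_def])
  \<comment> \<open>\<open>u\<close> agrees with the value function only at reachable nodes, which
    is all that \<open>Q\<close> and \<open>soft\<close> see from a reachable node.\<close>
  have vu: "Q (value_fun m (Suc k)) j = Q (u (Suc k)) j" "soft A e (value_fun m (Suc k)) j a = soft A e (u (Suc k)) j a"
    if "k < N" "j \<in> reach k" for k j a
    using that u[of "Suc k"] by (auto intro!: Q_cong soft_cong cA)
  show thesis
  proof (rule that[of m "\<lambda>k. soft A e (value_fun m (Suc k))"])
    show "m 0 = z0" by (simp add: m_def flow0)
    show "m k \<in> simplex_on (reach k)" for k by (simp add: m_def flow_simplex)
    show "soft A e (value_fun m (Suc k)) j a \<ge> 0" "(\<Sum>a\<in>A. soft A e (value_fun m (Suc k)) j a) = 1" for k j a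
      by (rule soft)+
    show "Q (value_fun m (Suc k)) j a \<le> Q (value_fun m (Suc k)) j b + e"
      if "soft A e (value_fun m (Suc k)) j a > 0" "b \<in> A" for k j a b
      using soft(3)[OF that(1)] val_le[OF cA that(2), of "value_fun m (Suc k)" j] by linarith
    show "m (Suc k) i = (\<Sum>j\<in>reach k. m k j * (\<Sum>a\<in>A. soft A e (value_fun m (Suc k)) j a * \<beta> j a i))"
      if "k < N" for k i
      unfolding m_def flow_Suc using vu(2)[OF that] by (simp add: m_def)
  qed
qed

text \<open>Optimality is asserted at every node, since the scheme asks for controls on the whole
  grid. The compactness argument serves the finitely many reachable nodes; elsewhere the masses
  vanish and any minimiser will do.\<close>

theorem equilibrium:
  obtains m a w where "m 0 = z0" "\<And>k. k \<le> N \<Longrightarrow> m k \<in> simplex_on (reach k)"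
    "\<And>k j l. \<lbrakk>k < N; l \<le> card (S j)\<rbrakk> \<Longrightarrow> a k j l \<in> K"
    "\<And>k j l b. \<lbrakk>k < N; l \<le> card (S j); b \<in> K\<rbrakk>
      \<Longrightarrow> Q (value_fun m (Suc k)) j (a k j l) \<le> Q (value_fun m (Suc k)) j b"
    "\<And>k j l. \<lbrakk>k < N; l \<le> card (S j)\<rbrakk> \<Longrightarrow> (0::real) \<le> w k j l"
    "\<And>k j. k < N \<Longrightarrow> (\<Sum>l\<le>card (S j). w k j l) = 1"
    "\<And>k i. k < N \<Longrightarrow> m (Suc k) i =
      (\<Sum>j\<in>reach k. m k j * (\<Sum>l\<le>card (S j). w k j l * \<beta> j (a k j l) i))"
proof -
  have "\<exists>A. finite A \<and> A \<subseteq> K \<and> K \<subseteq> (\<Union>x\<in>A. ball x (inverse (real (Suc n))))" for n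
    using seq_compact_imp_totally_bounded[OF K(1)[unfolded compact_eq_seq_compact_metric]] by simp
  then obtain A where A: "\<And>n. finite (A n)" "\<And>n. A n \<subseteq> K"
    "\<And>n. K \<subseteq> (\<Union>x\<in>A n. ball x (inverse (real (Suc n))))" by metis
  have Ane: "A n \<noteq> {}" for n using A(3)[of n] K(2) by auto
  define P where "P n m a w \<longleftrightarrow> m 0 = z0 \<and> (\<forall>k\<le>N. m k \<in> simplex_on (reach k)) \<and>
    (\<forall>k j l. k < N \<and> j \<in> reach k \<and> l \<le> card (S j) \<longrightarrow> a k j l \<in> K \<and> (0::real) \<le> w k j l \<and>
      (\<forall>b\<in>A n. Q (value_fun m (Suc k)) j (a k j l) \<le> Q (value_fun m (Suc k)) j b + inverse (real (Suc n)))) \<and>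
    (\<forall>k j. k < N \<and> j \<in> reach k \<longrightarrow> (\<Sum>l\<le>card (S j). w k j l) = 1) \<and>
    (\<forall>k i. k < N \<longrightarrow> m (Suc k) i =
      (\<Sum>j\<in>reach k. m k j * (\<Sum>l\<le>card (S j). w k j l * \<beta> j (a k j l) i)))" for n m a w
  have "\<exists>m a w. P n m a w" for n
  proof -
    have e: "inverse (real (Suc n)) > 0" by simp
    obtain m \<pi> where m: "m 0 = z0" "\<And>k. k \<le> N \<Longrightarrow> m k \<in> simplex_on (reach k)"
      and \<pi>: "\<And>k j a. \<pi> k j a \<ge> (0::real)" "\<And>k j. (\<Sum>a\<in>A n. \<pi> k j a) = 1"
      and opt: "\<And>k j a b. \<lbrakk>k < N; j \<in> reach k; a \<in> A n; \<pi> k j a > 0; b \<in> A n\<rbrakk>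
        \<Longrightarrow> Q (value_fun m (Suc k)) j a \<le> Q (value_fun m (Suc k)) j b + inverse (real (Suc n))"
      and step: "\<And>k i. k < N \<Longrightarrow> m (Suc k) i = (\<Sum>j\<in>reach k. m k j * (\<Sum>a\<in>A n. \<pi> k j a * \<beta> j a i))"
      using that by (rule approximate_equilibrium[OF A(1)[of n] Ane A(2) e])
    define R where "R k j a w \<longleftrightarrow> (\<forall>l\<le>card (S j). a l \<in> A n \<and> \<pi> k j (a l) > 0 \<and> (0::real) \<le> w l) \<and>
      (\<Sum>l\<le>card (S j). w l) = 1 \<and>
      (\<forall>i\<in>S j. (\<Sum>l\<le>card (S j). w l * \<beta> j (a l) i) = (\<Sum>b\<in>A n. \<pi> k j b * \<beta> j b i))" for k j a w
    have "\<exists>a w. R k j a w" for k j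
    proof -
      obtain a w where "\<And>l. l \<le> card (S j) \<Longrightarrow> a l \<in> A n \<and> \<pi> k j (a l) > 0"
        "\<And>l. l \<le> card (S j) \<Longrightarrow> w l \<ge> (0::real)" "(\<Sum>l\<le>card (S j). w l) = 1"
        "\<And>i. i \<in> S j \<Longrightarrow> (\<Sum>l\<le>card (S j). w l * \<beta> j (a l) i) = (\<Sum>b\<in>A n. \<pi> k j b * \<beta> j b i)"
        using that by (rule caratheodory_indexed[where \<phi> = "\<beta> j" and I = "S j" and S = "A n" and \<pi> = "\<pi> k j",
            OF S A(1) \<pi>(1) \<pi>(2)])
      then show ?thesis unfolding R_def by blast
    qed
    then obtain a w where "\<And>k j. R k j (a k j) (w k j)" by metis
    then have aw: "\<And>k j l. l \<le> card (S j) \<Longrightarrow> a k j l \<in> A n \<and> \<pi> k j (a k j l) > 0 \<and> (0::real) \<le> w k j l"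
      and aw1: "\<And>k j. (\<Sum>l\<le>card (S j). w k j l) = 1"
      and aw_eq: "\<And>k j i. i \<in> S j \<Longrightarrow> (\<Sum>l\<le>card (S j). w k j l * \<beta> j (a k j l) i) = (\<Sum>b\<in>A n. \<pi> k j b * \<beta> j b i)"
      unfolding R_def by blast+
    \<comment> \<open>Caratheodory's theorem preserves the transition weights on \<open>S j\<close>;
      off \<open>S j\<close> both sides vanish because all atoms lie in \<open>K\<close>.\<close>
    have eq: "(\<Sum>l\<le>card (S j). w k j l * \<beta> j (a k j l) i) = (\<Sum>b\<in>A n. \<pi> k j b * \<beta> j b i)" for k j i
    proof (cases "i \<in> S j")
      case False
      then show ?thesis using aw[of _ j k] A(2)[of n] by (simp add: \<beta>_zero subset_eq)
    qed (rule aw_eq)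
    show ?thesis
      using m opt step aw aw1 A(2)[of n]
      by (intro exI[of _ m] exI[of _ a] exI[of _ w]) (auto simp: P_def eq)
  qed
  then obtain M a w where "\<And>n. P n (M n) (a n) (w n)" by metis
  then have M: "\<And>n. M n 0 = z0" "\<And>n k. k \<le> N \<Longrightarrow> M n k \<in> simplex_on (reach k)"
    and a: "\<And>n k j l. \<lbrakk>k < N; j \<in> reach k; l \<le> card (S j)\<rbrakk> \<Longrightarrow> a n k j l \<in> K"
    and w: "\<And>n k j l. \<lbrakk>k < N; j \<in> reach k; l \<le> card (S j)\<rbrakk> \<Longrightarrow> (0::real) \<le> w n k j l"
    and opt: "\<And>n k j l b. \<lbrakk>k < N; j \<in> reach k; l \<le> card (S j); b \<in> A n\<rbrakk> \<Longrightarrow>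
      Q (value_fun (M n) (Suc k)) j (a n k j l) \<le> Q (value_fun (M n) (Suc k)) j b + inverse (real (Suc n))"
    and w1: "\<And>n k j. \<lbrakk>k < N; j \<in> reach k\<rbrakk> \<Longrightarrow> (\<Sum>l\<le>card (S j). w n k j l) = 1"
    and step: "\<And>n k i. k < N \<Longrightarrow> M n (Suc k) i =
      (\<Sum>j\<in>reach k. M n k j * (\<Sum>l\<le>card (S j). w n k j l * \<beta> j (a n k j l) i))"
    unfolding P_def by blast+
  \<comment> \<open>\<open>I\<close> indexes the masses and \<open>I'\<close> the slots of the mixed
    controls; \<open>I'\<close> stops before N because no action is taken at the final time.\<close>
  define I where "I = (SIGMA k:{..N}. reach k)"
  define I' where "I' = (SIGMA k:{..<N}. SIGMA j:reach k. {..card (S j)})"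
  have fin: "finite I" "finite I'" unfolding I_def I'_def using finite_reach by auto
  obtain r0 m0 where r0: "strict_mono r0"
    and m0: "\<And>p. p \<in> I \<Longrightarrow> (\<lambda>n. M (r0 n) (fst p) (snd p)) \<longlonglongrightarrow> m0 p"
  proof (rule finite_family_convergent_subsequence[where x = "\<lambda>n p. M n (fst p) (snd p)", OF fin(1)])
    fix n p assume "p \<in> I"
    then show "M n (fst p) (snd p) \<in> {0..1}"
      using simplex_onD(1)[OF M(2)] simplex_on_le_1[OF finite_reach M(2)] by (auto simp: I_def)
  qed auto
  \<comment> \<open>Atom and weight are paired so that a single extraction makes both
    converge.\<close>
  define aw where "aw n = (\<lambda>(k, j, l). (a (r0 n) k j l, w (r0 n) k j l))" for n
  obtain r1 L where r1: "strict_mono r1" and L: "\<And>p. p \<in> I' \<Longrightarrow> L p \<in> K \<times> {0..1}"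
    and Llim: "\<And>p. p \<in> I' \<Longrightarrow> (\<lambda>n. aw (r1 n) p) \<longlonglongrightarrow> L p"
  proof (rule finite_family_convergent_subsequence[where x = aw and C = "\<lambda>_. K \<times> {0..1}", OF fin(2)])
    show "compact (K \<times> {0..1::real})" by (intro compact_Times K compact_Icc)
    fix n p assume "p \<in> I'"
    then obtain k j l where p: "p = (k, j, l)" "k < N" "j \<in> reach k" "l \<le> card (S j)" by (auto simp: I'_def)
    have "w (r0 n) k j l \<le> (\<Sum>l\<le>card (S j). w (r0 n) k j l)"
      using p w[OF p(2,3)] by (intro member_le_sum) auto
    then show "aw n p \<in> K \<times> {0..1}" using p a w w1 by (auto simp: aw_def)
  qed auto
  define r where "r = r0 \<circ> r1"
  have r: "strict_mono r" unfolding r_def by (rule strict_mono_o[OF r0 r1])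
  define m where "m k j = (if k \<le> N \<and> j \<in> reach k then m0 (k, j) else 0)" for k j
  have mlim: "(\<lambda>n. M (r n) k j) \<longlonglongrightarrow> m k j" if "k \<le> N" for k j
  proof (cases "j \<in> reach k")
    case True
    then have "(k, j) \<in> I" using that by (auto simp: I_def)
    from LIMSEQ_subseq_LIMSEQ[OF m0[OF this] r1] show ?thesis
      using True that by (simp add: m_def r_def o_def)
  next
    case False
    then show ?thesis using simplex_onD(2)[OF M(2)[OF that]] by (simp add: m_def)
  qed
  have m: "m k \<in> simplex_on (reach k)" if "k \<le> N" for k
    by (rule simplex_on_limit[OF M(2)[OF that] mlim[OF that]])
  have vlim: "(\<lambda>n. value_fun (M (r n)) k j) \<longlonglongrightarrow> value_fun m k j" for k j
    by (intro value_fun_tendsto M m mlim)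
  \<comment> \<open>An exact minimiser for the limiting value function, used at nodes that no mass
    reaches.\<close>
  define b where "b k j = (SOME b. b \<in> K \<and> (\<forall>c\<in>K. Q (value_fun m (Suc k)) j b \<le> Q (value_fun m (Suc k)) j c))" for k j
  have b: "b k j \<in> K \<and> (\<forall>c\<in>K. Q (value_fun m (Suc k)) j (b k j) \<le> Q (value_fun m (Suc k)) j c)" for k j
    unfolding b_def by (rule someI_ex) (use val_attained[OF K order_refl] in blast)
  define \<alpha> where "\<alpha> k j l = (if j \<in> reach k then fst (L (k, j, l)) else b k j)" for k j l
  \<comment> \<open>At unreached nodes slot 0 takes all the weight, which keeps the total equal to
    1.\<close>
  define \<omega> where "\<omega> k j l = (if j \<in> reach k then snd (L (k, j, l)) else if l = 0 then 1 else 0)"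
    for k j and l :: nat
  have lims: "(\<lambda>n. a (r n) k j l) \<longlonglongrightarrow> \<alpha> k j l" "(\<lambda>n. w (r n) k j l) \<longlonglongrightarrow> \<omega> k j l" "\<alpha> k j l \<in> K"
    if "k < N" "j \<in> reach k" "l \<le> card (S j)" for k j l
  proof -
    have "(k, j, l) \<in> I'" using that by (auto simp: I'_def)
    from tendsto_fst[OF Llim[OF this]] tendsto_snd[OF Llim[OF this]] L[OF this]
    show "(\<lambda>n. a (r n) k j l) \<longlonglongrightarrow> \<alpha> k j l" "(\<lambda>n. w (r n) k j l) \<longlonglongrightarrow> \<omega> k j l" "\<alpha> k j l \<in> K"
      using that by (auto simp: aw_def \<alpha>_def \<omega>_def r_def o_def)
  qed
  have inv_lim: "(\<lambda>n. inverse (real (Suc (r n)))) \<longlonglongrightarrow> 0"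
    using LIMSEQ_subseq_LIMSEQ[OF LIMSEQ_inverse_real_of_nat r] by (simp add: o_def)
  show thesis
  proof (rule that[of m \<alpha> \<omega>])
    show "m 0 = z0"
    proof
      fix j show "m 0 j = z0 j" using mlim[of 0 j] M(1) by (simp add: LIMSEQ_const_iff)
    qed
    show "m k \<in> simplex_on (reach k)" if "k \<le> N" for k by (rule m[OF that])
    show "\<alpha> k j l \<in> K" if "k < N" "l \<le> card (S j)" for k j l
      using lims(3)[OF that(1) _ that(2)] b by (cases "j \<in> reach k") (auto simp: \<alpha>_def)
    show "0 \<le> \<omega> k j l" if "k < N" "l \<le> card (S j)" for k j l
    proof (cases "j \<in> reach k")
      case True
      show ?thesis
        by (rule LIMSEQ_le_const[OF lims(2)[OF that(1) True that(2)]])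
          (use w[OF that(1) True that(2)] in auto)
    qed (simp add: \<omega>_def)
    show "(\<Sum>l\<le>card (S j). \<omega> k j l) = 1" if "k < N" for k j
    proof (cases "j \<in> reach k")
      case True
      have "(\<lambda>n. \<Sum>l\<le>card (S j). w (r n) k j l) \<longlonglongrightarrow> (\<Sum>l\<le>card (S j). \<omega> k j l)"
        using that True by (intro tendsto_sum lims) auto
      then show ?thesis using w1[OF that True] by (simp add: LIMSEQ_const_iff)
    qed (simp add: \<omega>_def)
    show "m (Suc k) i = (\<Sum>j\<in>reach k. m k j * (\<Sum>l\<le>card (S j). \<omega> k j l * \<beta> j (\<alpha> k j l) i))"
      if "k < N" for k i
    proof (rule LIMSEQ_unique)
      show "(\<lambda>n. M (r n) (Suc k) i) \<longlonglongrightarrow> m (Suc k) i" using that by (intro mlim) auto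
      show "(\<lambda>n. M (r n) (Suc k) i) \<longlonglongrightarrow>
          (\<Sum>j\<in>reach k. m k j * (\<Sum>l\<le>card (S j). \<omega> k j l * \<beta> j (\<alpha> k j l) i))"
        unfolding step[OF that]
        using that a by (intro tendsto_intros mlim lims continuous_on_tendsto_compose[OF \<beta>_cont]
            always_eventually allI) auto
    qed
    show "Q (value_fun m (Suc k)) j (\<alpha> k j l) \<le> Q (value_fun m (Suc k)) j c"
      if "k < N" "l \<le> card (S j)" "c \<in> K" for k j l c
    proof (cases "j \<in> reach k")
      case False
      then show ?thesis using b that by (simp add: \<alpha>_def)
    next
      case True
      \<comment> \<open>At stage n the atoms are compared with net actions only, so the competitor
        \<open>c\<close> is approximated by points of the nets, whose mesh tends to 0.\<close>
      have "\<exists>c'\<in>A (r n). dist c' c < inverse (real (Suc (r n)))" for n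
        using A(3)[of "r n"] that(3) by (auto simp: subset_eq)
      then obtain c' where c': "\<And>n. c' n \<in> A (r n)" "\<And>n. dist (c' n) c < inverse (real (Suc (r n)))" by metis
      have c'K: "c' n \<in> K" for n using c'(1) A(2) by blast
      have "(\<lambda>n. dist (c' n) c) \<longlonglongrightarrow> 0"
        by (rule Lim_null_comparison[OF always_eventually[OF allI] inv_lim])
          (use c'(2) in \<open>simp add: less_imp_le\<close>)
      then have "c' \<longlonglongrightarrow> c" by (rule tendsto_dist_iff[THEN iffD2])
      then have "(\<lambda>n. Q (value_fun (M (r n)) (Suc k)) j (c' n) + inverse (real (Suc (r n)))) \<longlonglongrightarrow>
          Q (value_fun m (Suc k)) j c + 0"
        by (intro tendsto_add[OF Q_tendsto inv_lim] vlim c'K that(3))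
      moreover have "(\<lambda>n. Q (value_fun (M (r n)) (Suc k)) j (a (r n) k j l)) \<longlonglongrightarrow> Q (value_fun m (Suc k)) j (\<alpha> k j l)"
        using that True a by (intro Q_tendsto vlim lims) auto
      ultimately show ?thesis
        using opt[OF that(1) True that(2) c'(1)] LIMSEQ_le by fastforce
    qed
  qed
qed

end

section \<open>Grid and interpolation\<close>

lemma infnorm_le_iff_cart: "infnorm (x :: real ^ 'n) \<le> r \<longleftrightarrow> (\<forall>l. \<bar>x $ l\<bar> \<le> r)"
proof
  show "infnorm x \<le> r \<Longrightarrow> \<forall>l. \<bar>x $ l\<bar> \<le> r"
    using component_le_infnorm_cart order_trans by blast
  assume "\<forall>l. \<bar>x $ l\<bar> \<le> r"
  then show "infnorm x \<le> r" unfolding infnorm_cart by (intro cSup_least) auto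
qed

lemma infnorm_le_eq_cbox:
  "{x. infnorm (x - c) \<le> r} = cbox (\<chi> l. c $ l - r) (\<chi> l. c $ l + r)" for c :: "real ^ 'n"
  by (auto simp: infnorm_le_iff_cart mem_box_cart abs_le_iff algebra_simps)

lemma cell_eq_cbox: "cell dx i = cbox (\<chi> l. gridpt dx i $ l - dx / 2) (\<chi> l. gridpt dx i $ l + dx / 2)"
  unfolding cell_def infnorm_le_eq_cbox ..

lemma gridpt_nth [simp]: "gridpt dx i $ l = real_of_int (i $ l) * dx"
  by (simp add: gridpt_def)

lemma mem_cell: "x \<in> cell dx i \<longleftrightarrow> (\<forall>l. \<bar>x $ l - real_of_int (i $ l) * dx\<bar> \<le> dx / 2)"
  by (simp only: cell_def mem_Collect_eq infnorm_le_iff_cart vector_minus_component gridpt_nth)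

lemma compact_cell: "compact (cell dx i)"
  by (simp add: cell_eq_cbox)

lemma cell_borel [measurable]: "cell dx i \<in> sets borel"
  by (simp add: cell_eq_cbox)

lemma measure_cell: "dx > 0 \<Longrightarrow> measure lborel (cell dx (i :: int ^ 'n)) = dx ^ CARD('n)"
proof -
  assume dx: "dx > 0"
  let ?d = "\<chi> l. gridpt dx i $ l - dx / 2" and ?u = "\<chi> l. gridpt dx i $ l + dx / 2"
  have side: "?u \<bullet> b - ?d \<bullet> b = dx" if "b \<in> Basis" for b
    using that by (auto simp: Basis_vec_def inner_axis)
  then have "measure lborel (cell dx i) = (\<Prod>b\<in>(Basis :: (real ^ 'n) set). dx)"
    unfolding cell_eq_cbox using dx by (subst measure_lborel_cbox) (auto simp: inner_diff_left algebra_simps intro!: prod.cong)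
  also have "\<dots> = dx ^ DIM(real ^ 'n)" by (rule prod_constant)
  finally show ?thesis by (simp add: DIM_cart)
qed

section \<open>The multilinear basis as a partition of unity\<close>

lemma bij_betw_int_box:
  "bij_betw vec_lambda (Pi\<^sub>E UNIV (\<lambda>l. {lo l..hi l})) {i :: int ^ 'n. \<forall>l. lo l \<le> i $ l \<and> i $ l \<le> hi l}"
  by (rule bij_betw_byWitness[where f' = vec_nth]) (auto simp: PiE_iff)

lemma finite_int_box: "finite {i :: int ^ 'n. \<forall>l. lo l \<le> i $ l \<and> i $ l \<le> hi l}"
  using bij_betw_finite[OF bij_betw_int_box[of lo hi]] finite_PiE[of UNIV "\<lambda>l. {lo l..hi l}"] by simp

lemma Q1basis_nonneg: "0 \<le> Q1basis dx i x"
  unfolding Q1basis_def by (intro prod_nonneg) auto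

lemma scaled_abs_diff: "dx > 0 \<Longrightarrow> \<bar>y - t * dx\<bar> / dx = \<bar>y / dx - t\<bar>" for dx y t :: real
  using abs_divide[of "y - t * dx" dx] by (simp add: diff_divide_distrib)

text \<open>Only the two nodes next to \<open>y\<close> contribute; with \<theta> the fractional
  part of \<open>y / dx\<close> they contribute 1 - \<theta> and \<theta>.\<close>

lemma hat_sum:
  fixes y dx :: real
  assumes dx: "dx > 0" and "a \<le> \<lfloor>y / dx\<rfloor>" "\<lfloor>y / dx\<rfloor> + 1 \<le> b"
  shows "(\<Sum>t\<in>{a..b}. max 0 (1 - \<bar>y - real_of_int t * dx\<bar> / dx)) = 1"
proof -
  define s where "s = \<lfloor>y / dx\<rfloor>"
  note eq = scaled_abs_diff[OF dx]
  have fl: "real_of_int s \<le> y / dx" "y / dx < real_of_int s + 1" unfolding s_def by linarith+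
  have "(\<Sum>t\<in>{a..b}. max 0 (1 - \<bar>y / dx - real_of_int t\<bar>)) = (\<Sum>t\<in>{s, s + 1}. max 0 (1 - \<bar>y / dx - real_of_int t\<bar>))"
  proof (rule sum.mono_neutral_right)
    show "\<forall>t\<in>{a..b} - {s, s + 1}. max 0 (1 - \<bar>y / dx - real_of_int t\<bar>) = 0"
    proof
      fix t assume "t \<in> {a..b} - {s, s + 1}"
      then have "t \<le> s - 1 \<or> t \<ge> s + 2" by auto
      then have "real_of_int t \<le> real_of_int s - 1 \<or> real_of_int t \<ge> real_of_int s + 2" by linarith
      then show "max 0 (1 - \<bar>y / dx - real_of_int t\<bar>) = 0" using fl by linarith
    qed
  qed (use assms in \<open>auto simp: s_def\<close>)
  also have "\<dots> = 1" using fl by simp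
  finally show ?thesis by (simp only: eq)
qed

text \<open>Distributivity turns the sum over a box of products into a product of one-dimensional
  hat sums, each equal to 1.\<close>

lemma Q1basis_sum:
  fixes x :: "real ^ 'n"
  assumes dx: "dx > 0" and lo: "\<And>l. lo l \<le> \<lfloor>x $ l / dx\<rfloor>" and hi: "\<And>l. \<lfloor>x $ l / dx\<rfloor> + 1 \<le> hi l"
  shows "(\<Sum>i | \<forall>l. lo l \<le> i $ l \<and> i $ l \<le> hi l. Q1basis dx i x) = 1"
proof -
  have "(\<Sum>i | \<forall>l. lo l \<le> i $ l \<and> i $ l \<le> hi l. Q1basis dx i x) =
      (\<Sum>h\<in>Pi\<^sub>E UNIV (\<lambda>l. {lo l..hi l}). \<Prod>l\<in>UNIV. max 0 (1 - \<bar>x $ l - real_of_int (h l) * dx\<bar> / dx))"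
    using sum.reindex_bij_betw[OF bij_betw_int_box[of lo hi], of "\<lambda>i. Q1basis dx i x"]
    by (simp add: Q1basis_def)
  also have "\<dots> = (\<Prod>l\<in>UNIV. \<Sum>t\<in>{lo l..hi l}. max 0 (1 - \<bar>x $ l - real_of_int t * dx\<bar> / dx))"
    by (rule prod_sum_PiE[symmetric]) auto
  also have "\<dots> = 1" using hat_sum[OF dx lo hi] by simp
  finally show ?thesis .
qed

lemma Q1basis_eq_0:
  assumes dx: "dx > 0" and "i $ l < \<lfloor>x $ l / dx\<rfloor> \<or> \<lfloor>x $ l / dx\<rfloor> + 1 < i $ l"
  shows "Q1basis dx i x = 0"
proof -
  have "real_of_int (i $ l) + 1 \<le> x $ l / dx \<or> x $ l / dx + 1 \<le> real_of_int (i $ l)"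
    using assms(2) by linarith
  then have "1 \<le> \<bar>x $ l / dx - real_of_int (i $ l)\<bar>" by linarith
  also have "\<dots> = \<bar>x $ l - real_of_int (i $ l) * dx\<bar> / dx"
    by (rule scaled_abs_diff[OF dx, symmetric])
  finally have "max 0 (1 - \<bar>x $ l - gridpt dx i $ l\<bar> / dx) = 0" by simp
  then show ?thesis unfolding Q1basis_def by (intro prod_zero) auto
qed

lemma continuous_on_Q1basis: "continuous_on A (Q1basis dx i)"
  unfolding Q1basis_def by (cases "dx = 0") (auto intro!: continuous_intros)

lemma finite_sum_infsum:
  assumes "finite A" "\<And>i. i \<notin> A \<Longrightarrow> h i = (0::real)"
  shows "(\<Sum>\<^sub>\<infinity>i. h i) = sum h A"
  using infsum_cong_neutral[of A UNIV h h] assms by auto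

text \<open>The radius \<open>r\<close> will be dt * C / dx, the largest displacement in mesh units.
  The additional 1 makes room for the upper neighbour of the floor, and the same margin is kept
  below.\<close>

definition stencil :: "real \<Rightarrow> int ^ 'n \<Rightarrow> (int ^ 'n) set" where
  "stencil r j = {i. \<forall>l. j $ l - (\<lceil>r\<rceil> + 1) \<le> i $ l \<and> i $ l \<le> j $ l + (\<lceil>r\<rceil> + 1)}"

lemma finite_stencil: "finite (stencil r j)"
  unfolding stencil_def by (rule finite_int_box)

context
  fixes dx dt C :: real and a :: "real ^ 'n"
  assumes dx: "dx > 0" and dt: "dt > 0" and a: "infnorm a \<le> C"
begin

lemma floor_shifted_gridpt:
  "j $ l - (\<lceil>dt * C / dx\<rceil> + 1) \<le> \<lfloor>(gridpt dx j - dt *\<^sub>R a) $ l / dx\<rfloor>"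
  "\<lfloor>(gridpt dx j - dt *\<^sub>R a) $ l / dx\<rfloor> + 1 \<le> j $ l + (\<lceil>dt * C / dx\<rceil> + 1)"
proof -
  have "\<bar>dt * a $ l\<bar> \<le> dt * C" using a dt by (simp add: infnorm_le_iff_cart abs_mult)
  then have "\<bar>dt * a $ l / dx\<bar> \<le> dt * C / dx" using dx by (simp add: abs_divide divide_right_mono)
  moreover have "(gridpt dx j - dt *\<^sub>R a) $ l / dx = real_of_int (j $ l) - dt * a $ l / dx"
    using dx by (simp add: diff_divide_distrib)
  ultimately show "j $ l - (\<lceil>dt * C / dx\<rceil> + 1) \<le> \<lfloor>(gridpt dx j - dt *\<^sub>R a) $ l / dx\<rfloor>"
    "\<lfloor>(gridpt dx j - dt *\<^sub>R a) $ l / dx\<rfloor> + 1 \<le> j $ l + (\<lceil>dt * C / dx\<rceil> + 1)"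
    by linarith+
qed

lemma Q1basis_stencil_sum: "(\<Sum>i\<in>stencil (dt * C / dx) j. Q1basis dx i (gridpt dx j - dt *\<^sub>R a)) = 1"
  unfolding stencil_def by (rule Q1basis_sum[OF dx floor_shifted_gridpt])

lemma Q1basis_stencil_zero:
  assumes "i \<notin> stencil (dt * C / dx) j"
  shows "Q1basis dx i (gridpt dx j - dt *\<^sub>R a) = 0"
proof -
  obtain l where "\<not> (j $ l - (\<lceil>dt * C / dx\<rceil> + 1) \<le> i $ l \<and> i $ l \<le> j $ l + (\<lceil>dt * C / dx\<rceil> + 1))"
    using assms by (auto simp: stencil_def)
  then show ?thesis using floor_shifted_gridpt[of j l] by (intro Q1basis_eq_0[OF dx, of _ l]) linarith
qed

text \<open>At points attainable by an admissible action the infinite interpolation sum becomes the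
  finite sum occurring in \<open>Q\<close>, with a stencil independent of the action.\<close>

lemma interp_stencil:
  "interp dx u (gridpt dx j - dt *\<^sub>R a) =
    (\<Sum>i\<in>stencil (dt * C / dx) j. u i * Q1basis dx i (gridpt dx j - dt *\<^sub>R a))"
  unfolding interp_def by (rule finite_sum_infsum) (simp_all add: finite_stencil Q1basis_stencil_zero)

end

section \<open>Grid measures and averaged couplings\<close>

lemma cell_set_integrable:
  fixes \<phi> :: "real ^ 'n \<Rightarrow> real"
  assumes "continuous_on UNIV \<phi>"
  shows "set_integrable lborel (cell dx i) \<phi>"
  unfolding set_integrable_def
  by (rule borel_integrable_compact[OF compact_cell continuous_on_subset[OF assms subset_UNIV]])

lemma cell_integral_const: "dx > 0 \<Longrightarrow> (LBINT x:cell dx (i :: int ^ 'n). c) = c * dx ^ CARD('n)" for c :: real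
  using measure_cell[of dx i] by (simp add: set_lebesgue_integral_def)

lemma abs_cell_integral_le:
  fixes \<phi> :: "real ^ 'n \<Rightarrow> real"
  assumes dx: "dx > 0" and \<phi>: "continuous_on UNIV \<phi>" and B: "\<And>x. x \<in> cell dx i \<Longrightarrow> \<bar>\<phi> x\<bar> \<le> B"
  shows "\<bar>LBINT x:cell dx i. \<phi> x\<bar> \<le> B * dx ^ CARD('n)"
proof -
  have "\<bar>LBINT x:cell dx i. \<phi> x\<bar> \<le> (\<integral>x. norm (indicator (cell dx i) x *\<^sub>R \<phi> x) \<partial>lborel)"
    unfolding set_lebesgue_integral_def real_norm_def[symmetric] by (rule integral_norm_bound)
  also have "\<dots> \<le> (LBINT x:cell dx i. B)"
    unfolding set_lebesgue_integral_def
    using cell_set_integrable[OF \<phi>, of dx i] cell_set_integrable[of "\<lambda>_. B" dx i] B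
    by (intro integral_mono integrable_norm) (auto simp: set_integrable_def indicator_def)
  finally show ?thesis by (simp add: cell_integral_const[OF dx])
qed

lemma finite_simplex_on_grid_simplex:
  assumes "finite J" "z \<in> simplex_on J"
  shows "z \<in> grid_simplex"
proof -
  have "(z has_sum sum z J) J" by (rule has_sum_finite[OF assms(1)])
  moreover have "(z has_sum sum z J) J \<longleftrightarrow> (z has_sum sum z J) UNIV"
    by (rule has_sum_cong_neutral) (use simplex_onD(2)[OF assms(2)] in auto)
  ultimately show ?thesis using simplex_onD[OF assms(2)] by (auto simp: grid_simplex_def)
qed

context
  fixes dx :: real and J :: "(int ^ 'n) set"
  assumes dx: "dx > 0" and J: "finite J"
begin

text \<open>For finitely supported weights the density is a finite sum and can be integrated cell by
  cell; shared faces cause no trouble because only linearity is used.\<close>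

lemma grid_measure_integral:
  fixes \<phi> :: "real ^ 'n \<Rightarrow> real"
  assumes z: "z \<in> simplex_on J" and \<phi>: "continuous_on UNIV \<phi>"
  shows "integrable (grid_measure dx z) \<phi>"
    and "(\<integral>x. \<phi> x \<partial>grid_measure dx z) = (\<Sum>i\<in>J. z i * ((LBINT x:cell dx i. \<phi> x) / dx ^ CARD('n)))"
proof -
  define h where "h x = 1 / dx ^ CARD('n) * (\<Sum>i\<in>J. z i * indicator (cell dx i) x)" for x :: "real ^ 'n"
  have gm: "grid_measure dx z = density lborel (\<lambda>x. ennreal (h x))"
    unfolding grid_measure_def h_def using simplex_onD(2)[OF z] J by (subst finite_sum_infsum) auto
  have [measurable]: "\<phi> \<in> borel_measurable borel" by (rule borel_measurable_continuous_onI[OF \<phi>])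
  have [measurable]: "h \<in> borel_measurable borel" unfolding h_def by measurable
  have hnn: "h x \<ge> 0" for x
    unfolding h_def using dx simplex_onD(1)[OF z] by (intro mult_nonneg_nonneg sum_nonneg) auto
  define k where "k i x = indicator (cell dx i) x *\<^sub>R \<phi> x" for i x
  have eq: "h x * \<phi> x = (\<Sum>i\<in>J. z i / dx ^ CARD('n) * k i x)" for x
    by (simp add: h_def k_def sum_distrib_left sum_distrib_right mult_ac)
  have int: "integrable lborel (k i)" for i
    using cell_set_integrable[OF \<phi>, of dx i] unfolding set_integrable_def k_def .
  show "integrable (grid_measure dx z) \<phi>"
    unfolding gm using int hnn by (subst integrable_density) (simp_all add: eq)
  have "(\<integral>x. \<phi> x \<partial>grid_measure dx z) = (\<integral>x. h x * \<phi> x \<partial>lborel)"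
    unfolding gm using hnn by (subst integral_density) auto
  also have "\<dots> = (\<Sum>i\<in>J. z i / dx ^ CARD('n) * (LBINT x:cell dx i. \<phi> x))"
    unfolding eq set_lebesgue_integral_def k_def[symmetric] using int
    by (subst Bochner_Integration.integral_sum) auto
  finally show "(\<integral>x. \<phi> x \<partial>grid_measure dx z) = (\<Sum>i\<in>J. z i * ((LBINT x:cell dx i. \<phi> x) / dx ^ CARD('n)))"
    by simp
qed

lemma grid_measure_P1:
  assumes z: "z \<in> simplex_on J"
  shows "grid_measure dx z \<in> P1"
proof -
  let ?M = "grid_measure dx z"
  note one = grid_measure_integral[OF z, of "\<lambda>_. 1"]
  have "measure ?M (space ?M) = 1"
    using one(2) dx simplex_onD(3)[OF z] by (simp add: cell_integral_const)
  moreover have "emeasure ?M (space ?M) < \<infinity>" using one(1) by (simp add: integrable_iff_bounded)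
  ultimately have "prob_space ?M"
    by (intro prob_spaceI) (simp add: emeasure_eq_ennreal_measure)
  moreover have "integrable ?M norm" by (rule grid_measure_integral[OF z]) (intro continuous_intros)
  ultimately show ?thesis by (simp add: P1_def grid_measure_def)
qed

text \<open>Both vectors sum to one, so a 1-Lipschitz test function may be shifted to vanish at 0.\<close>
lemma d1_grid_measure_le:
  assumes z: "z \<in> simplex_on J" and z': "z' \<in> simplex_on J"
    and R: "\<And>i. i \<in> J \<Longrightarrow> cell dx i \<subseteq> cball 0 R"
  shows "d1 (grid_measure dx z) (grid_measure dx z') \<le> R * (\<Sum>i\<in>J. \<bar>z i - z' i\<bar>)"
  unfolding d1_def
proof (rule cSUP_least)
  have "1-lipschitz_on UNIV (\<lambda>x :: real ^ 'n. 0 :: real)" by (auto intro: lipschitz_onI)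
  then show "{\<phi> :: real ^ 'n \<Rightarrow> real. 1-lipschitz_on UNIV \<phi>} \<noteq> {}" by blast
  fix \<phi> :: "real ^ 'n \<Rightarrow> real"
  assume "\<phi> \<in> {\<phi>. 1-lipschitz_on UNIV \<phi>}"
  then have lip: "1-lipschitz_on UNIV \<phi>" by simp
  then have \<phi>: "continuous_on UNIV \<phi>" by (rule lipschitz_on_continuous_on)
  \<comment> \<open>The average of \<open>\<phi>\<close> over a cell; as the cell lies in the ball
    of radius R, it differs from \<open>\<phi> 0\<close> by at most R.\<close>
  define c where "c i = (LBINT x:cell dx i. \<phi> x) / dx ^ CARD('n)" for i
  have c: "\<bar>c i - \<phi> 0\<bar> \<le> R" if "i \<in> J" for i
  proof -
    have "\<bar>LBINT x:cell dx i. \<phi> x - \<phi> 0\<bar> \<le> R * dx ^ CARD('n)"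
    proof (rule abs_cell_integral_le[OF dx])
      show "continuous_on UNIV (\<lambda>x. \<phi> x - \<phi> 0)" by (intro continuous_intros \<phi>)
      show "\<bar>\<phi> x - \<phi> 0\<bar> \<le> R" if "x \<in> cell dx i" for x
        using lipschitz_onD[OF lip, of x 0] R[OF \<open>i \<in> J\<close>] that by (force simp: dist_norm)
    qed
    moreover have "(LBINT x:cell dx i. \<phi> x - \<phi> 0) = (c i - \<phi> 0) * dx ^ CARD('n)"
      using dx cell_set_integrable[OF \<phi>, of dx i] cell_set_integrable[of "\<lambda>_. \<phi> 0" dx i]
      by (simp add: set_integral_diff cell_integral_const c_def left_diff_distrib)
    ultimately show ?thesis using dx by (simp add: abs_mult)
  qed
  have "(\<integral>x. \<phi> x \<partial>grid_measure dx z) - (\<integral>x. \<phi> x \<partial>grid_measure dx z') = (\<Sum>i\<in>J. (z i - z' i) * c i)"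
    by (simp add: grid_measure_integral(2)[OF z \<phi>] grid_measure_integral(2)[OF z' \<phi>] c_def
        sum_subtractf left_diff_distrib diff_divide_distrib)
  also have "\<dots> = (\<Sum>i\<in>J. (z i - z' i) * (c i - \<phi> 0)) + \<phi> 0 * (sum z J - sum z' J)"
    by (simp add: right_diff_distrib left_diff_distrib sum_subtractf sum_distrib_left sum_distrib_right mult_ac)
  also have "\<dots> = (\<Sum>i\<in>J. (z i - z' i) * (c i - \<phi> 0))"
    using simplex_onD(3)[OF z] simplex_onD(3)[OF z'] by simp
  also have "\<dots> \<le> (\<Sum>i\<in>J. \<bar>z i - z' i\<bar> * R)"
  proof (rule sum_mono)
    fix i assume "i \<in> J"
    have "(z i - z' i) * (c i - \<phi> 0) \<le> \<bar>z i - z' i\<bar> * \<bar>c i - \<phi> 0\<bar>"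
      by (metis abs_ge_self abs_mult)
    also have "\<dots> \<le> \<bar>z i - z' i\<bar> * R" using c[OF \<open>i \<in> J\<close>] by (intro mult_left_mono) auto
    finally show "(z i - z' i) * (c i - \<phi> 0) \<le> \<bar>z i - z' i\<bar> * R" .
  qed
  finally show "(\<integral>x. \<phi> x \<partial>grid_measure dx z) - (\<integral>x. \<phi> x \<partial>grid_measure dx z') \<le> R * (\<Sum>i\<in>J. \<bar>z i - z' i\<bar>)"
    by (simp add: sum_distrib_left mult.commute)
qed

text \<open>The common finite support puts all the measures in one ball, so convergence of the
  weights controls the distance. On the infinite grid, mass escaping far away could spoil
  this.\<close>

lemma grid_measure_d1_eventually:
  assumes Z: "\<And>n. Z n \<in> simplex_on J" and z: "z \<in> simplex_on J"
    and lim: "\<And>j. (\<lambda>n. Z n j) \<longlonglongrightarrow> z j" and "\<delta> > 0"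
  shows "\<forall>\<^sub>F n in sequentially. d1 (grid_measure dx (Z n)) (grid_measure dx z) < \<delta>"
proof -
  have "bounded (\<Union>i\<in>J. cell dx i)" by (intro bounded_UN J ballI compact_imp_bounded compact_cell)
  then obtain R where R: "(\<Union>i\<in>J. cell dx i) \<subseteq> cball 0 R"
    unfolding bounded_iff by (meson mem_cball_0 subsetI)
  have "(\<lambda>n. R * (\<Sum>i\<in>J. \<bar>Z n i - z i\<bar>)) \<longlonglongrightarrow> R * (\<Sum>i\<in>J. \<bar>z i - z i\<bar>)"
    by (intro tendsto_intros lim)
  then have "\<forall>\<^sub>F n in sequentially. R * (\<Sum>i\<in>J. \<bar>Z n i - z i\<bar>) < \<delta>"
    using \<open>\<delta> > 0\<close> by (intro order_tendstoD) auto
  then show ?thesis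
  proof (rule eventually_mono)
    fix n assume "R * (\<Sum>i\<in>J. \<bar>Z n i - z i\<bar>) < \<delta>"
    moreover have "d1 (grid_measure dx (Z n)) (grid_measure dx z) \<le> R * (\<Sum>i\<in>J. \<bar>Z n i - z i\<bar>)"
      by (rule d1_grid_measure_le[OF Z z]) (use R in blast)
    ultimately show "d1 (grid_measure dx (Z n)) (grid_measure dx z) < \<delta>" by linarith
  qed
qed

end

text \<open>Serves to freeze the measure in \<open>continuous_coupling\<close> and obtain continuity
  in the space variable alone.\<close>

lemma d1_self: "d1 \<mu> \<mu> = 0"
proof -
  have "1-lipschitz_on UNIV (\<lambda>x :: 'a. 0 :: real)" by (auto intro: lipschitz_onI)
  then have "{\<phi> :: 'a \<Rightarrow> real. 1-lipschitz_on UNIV \<phi>} \<noteq> {}" by blast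
  then show ?thesis by (simp add: d1_def)
qed

lemma continuous_coupling_continuous_on:
  assumes "continuous_coupling F" "\<eta> \<in> P1"
  shows "continuous_on UNIV (\<lambda>x. F x \<eta>)"
  unfolding continuous_on_iff
proof (intro ballI allI impI)
  fix x and e :: real assume "e > 0"
  then obtain \<delta> where "\<delta> > 0" "\<forall>y. \<forall>\<nu>\<in>P1. dist y x < \<delta> \<and> d1 \<nu> \<eta> < \<delta> \<longrightarrow> \<bar>F y \<nu> - F x \<eta>\<bar> < e"
    using assms unfolding continuous_coupling_def by meson
  then show "\<exists>d>0. \<forall>x'\<in>UNIV. dist x' x < d \<longrightarrow> dist (F x' \<eta>) (F x \<eta>) < e"
    using assms(2) by (intro exI[of _ \<delta>]) (auto simp: d1_self dist_real_def)
qed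

context
  fixes dx :: real and J :: "(int ^ 'n) set" and F :: "real ^ 'n \<Rightarrow> (real ^ 'n) measure \<Rightarrow> real" and B :: real
  assumes dx: "dx > 0" and J: "finite J" and F: "continuous_coupling F"
    and F_bound: "\<And>x \<eta>. \<eta> \<in> P1 \<Longrightarrow> \<bar>F x \<eta>\<bar> \<le> B"
begin

lemma cell_average_bound:
  assumes "z \<in> simplex_on J"
  shows "\<bar>cell_average dx F i z\<bar> \<le> B"
proof -
  note P1 = grid_measure_P1[OF dx J assms]
  have "\<bar>LBINT x:cell dx i. F x (grid_measure dx z)\<bar> \<le> B * dx ^ CARD('n)"
    by (rule abs_cell_integral_le[OF dx continuous_coupling_continuous_on[OF F P1] F_bound[OF P1]])
  then show ?thesis using dx by (simp add: cell_average_def abs_mult field_simps)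
qed

text \<open>Dominated convergence on the cell: continuity in the measure gives pointwise convergence
  of the integrand, and the uniform bound B dominates.\<close>

lemma cell_average_tendsto:
  assumes Z: "\<And>n. Z n \<in> simplex_on J" and z: "z \<in> simplex_on J"
    and lim: "\<And>j. (\<lambda>n. Z n j) \<longlonglongrightarrow> z j"
  shows "(\<lambda>n. cell_average dx F i (Z n)) \<longlonglongrightarrow> cell_average dx F i z"
proof -
  note P1 = grid_measure_P1[OF dx J]
  have meas: "(\<lambda>x. indicator (cell dx i) x *\<^sub>R F x (grid_measure dx z)) \<in> borel_measurable lborel"
    if "z \<in> simplex_on J" for z
    using cell_set_integrable[OF continuous_coupling_continuous_on[OF F P1[OF that]], of dx i]
    unfolding set_integrable_def by auto
  have ptw: "(\<lambda>n. F x (grid_measure dx (Z n))) \<longlonglongrightarrow> F x (grid_measure dx z)" for x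
  proof (rule tendstoI)
    fix e :: real assume "e > 0"
    then obtain \<delta> where \<delta>: "\<delta> > 0" "\<forall>y. \<forall>\<nu>\<in>P1. dist y x < \<delta> \<and> d1 \<nu> (grid_measure dx z) < \<delta> \<longrightarrow>
        \<bar>F y \<nu> - F x (grid_measure dx z)\<bar> < e"
      using F P1[OF z] unfolding continuous_coupling_def by meson
    from grid_measure_d1_eventually[OF dx J Z z lim \<delta>(1)]
    show "\<forall>\<^sub>F n in sequentially. dist (F x (grid_measure dx (Z n))) (F x (grid_measure dx z)) < e"
      by (rule eventually_mono) (use \<delta> P1[OF Z] in \<open>auto simp: dist_real_def\<close>)
  qed
  have "(\<lambda>n. LBINT x:cell dx i. F x (grid_measure dx (Z n))) \<longlonglongrightarrow> (LBINT x:cell dx i. F x (grid_measure dx z))"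
    unfolding set_lebesgue_integral_def
  proof (rule integral_dominated_convergence[where w = "\<lambda>x. indicator (cell dx i) x *\<^sub>R B"])
    show "integrable lborel (\<lambda>x. indicator (cell dx i) x *\<^sub>R B)"
      using cell_set_integrable[of "\<lambda>_. B" dx i] by (simp add: set_integrable_def)
    show "AE x in lborel. (\<lambda>n. indicator (cell dx i) x *\<^sub>R F x (grid_measure dx (Z n)))
        \<longlonglongrightarrow> indicator (cell dx i) x *\<^sub>R F x (grid_measure dx z)"
      by (intro AE_I2 tendsto_scaleR tendsto_const ptw)
    show "AE x in lborel. norm (indicator (cell dx i) x *\<^sub>R F x (grid_measure dx (Z n)))
        \<le> indicator (cell dx i) x *\<^sub>R B" for n
      using F_bound[OF P1[OF Z]] by (intro AE_I2) (simp add: indicator_def)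
  qed (intro meas Z z)+
  then show ?thesis unfolding cell_average_def by (intro tendsto_mult tendsto_const)
qed

end

section \<open>Supports, initial cell masses and finite mixtures of actions\<close>

lemma AE_meas_supp:
  fixes \<mu> :: "'a::second_countable_topology measure"
  assumes "sets \<mu> = sets borel"
  shows "AE x in \<mu>. x \<in> meas_supp \<mu>"
proof -
  \<comment> \<open>The complement of the support is the union of all open null sets; Lindelof's
    property reduces it to a countable union.\<close>
  let ?\<U> = "{U. open U \<and> emeasure \<mu> U = 0}"
  obtain \<V> where \<V>: "\<V> \<subseteq> ?\<U>" "countable \<V>" "\<Union>\<V> = \<Union>?\<U>"
    using Lindelof[of ?\<U>] by auto
  have "U \<in> null_sets \<mu>" if "U \<in> \<V>" for U
    using \<V>(1) assms that by (auto simp: null_sets_def)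
  then have "(\<Union>U\<in>\<V>. U) \<in> null_sets \<mu>" by (rule null_sets_UN'[OF \<V>(2)])
  moreover have "{x \<in> space \<mu>. x \<notin> meas_supp \<mu>} \<subseteq> (\<Union>U\<in>\<V>. U)"
    using \<V>(3) by (auto simp: meas_supp_def not_gr_zero)
  ultimately show ?thesis by (rule AE_I')
qed

text \<open>Two closed unit intervals whose centres are at distance at least 1 share at most the
  midpoint of the centres. Hence distinct cells meet inside a hyperplane.\<close>

lemma midpoint_unique:
  fixes y p q :: real
  assumes "\<bar>y - p\<bar> \<le> 1 / 2" "\<bar>y - q\<bar> \<le> 1 / 2" "p + 1 \<le> q \<or> q + 1 \<le> p"
  shows "y = (p + q) / 2"
proof -
  have "y \<le> p + 1 / 2" "p - 1 / 2 \<le> y" "y \<le> q + 1 / 2" "q - 1 / 2 \<le> y"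
    using assms(1,2) by linarith+
  with assms(3) show ?thesis by auto
qed

text \<open>Closed cells overlap on faces. A measure with a density does not charge hyperplanes, so
  the cell masses still add up to 1; bounded support leaves only finitely many of them
  nonzero.\<close>

lemma cell_mass_simplex:
  fixes m :: "(real ^ 'n) measure" and \<rho> :: "real ^ 'n \<Rightarrow> ennreal"
  assumes dx: "dx > 0" and m: "m \<in> P1" "m = density lborel \<rho>" "\<rho> \<in> borel_measurable borel"
    and supp: "meas_supp m \<subseteq> cball 0 R"
  shows "\<exists>J. finite J \<and> (\<lambda>i. measure m (cell dx i)) \<in> simplex_on J"
proof -
  interpret prob_space m using m(1) by (simp add: P1_def)
  have sets [measurable_cong, simp]: "sets m = sets borel" using m(1) by (simp add: P1_def)
  \<comment> \<open>In mesh units a point of the ball has coordinates of size at most R/dx, and a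
    cell containing it is centred within 1/2 of it; R/dx + 1/2 is below \<open>M\<close>.\<close>
  define M where "M = \<lceil>R / dx\<rceil> + 1"
  define J where "J = {i :: int ^ 'n. \<forall>l. - M \<le> i $ l \<and> i $ l \<le> M}"
  have finJ: "finite J" unfolding J_def by (rule finite_int_box)
  have inR: "AE x in m. x \<in> cball 0 R"
    using AE_meas_supp[OF sets] by eventually_elim (use supp in auto)
  have comp: "\<bar>x $ l / dx\<bar> \<le> R / dx" if "x \<in> cball 0 R" for x :: "real ^ 'n" and l
    using component_le_norm_cart[of x l] that dx by (simp add: abs_divide divide_right_mono)
  have cellD: "\<bar>x $ l / dx - real_of_int (i $ l)\<bar> \<le> 1 / 2" if "x \<in> cell dx i" for x i l
  proof -
    have "\<bar>x $ l - real_of_int (i $ l) * dx\<bar> / dx \<le> (dx / 2) / dx"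
      using that dx by (intro divide_right_mono) (auto simp: mem_cell)
    then show ?thesis using dx by (simp add: scaled_abs_diff)
  qed
  have zero: "measure m (cell dx i) = 0" if i: "i \<notin> J" for i
  proof -
    obtain l where "\<not> (- M \<le> i $ l \<and> i $ l \<le> M)" using i unfolding J_def by blast
    then have l: "i $ l < - M \<or> M < i $ l" by linarith
    have "AE x in m. x \<notin> cell dx i"
      using inR
    proof (eventually_elim, intro notI)
      fix x assume "x \<in> cball 0 R" "x \<in> cell dx i"
      then show False using comp[of x l] cellD[of x i l] l unfolding M_def by linarith
    qed
    then have "AE x in m. x \<in> cell dx i \<longleftrightarrow> x \<in> {}" by eventually_elim auto
    then have "measure m (cell dx i) = measure m {}"
      by (intro finite_measure_eq_AE) auto
    then show ?thesis by simp
  qed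
  have overlap: "AE x in m. x \<notin> cell dx i \<or> x \<notin> cell dx j" if ij: "i \<noteq> j" for i j
  proof -
    obtain l where l: "i $ l \<noteq> j $ l" using ij unfolding vec_eq_iff by blast
    define c where "c = dx * (real_of_int (i $ l) + real_of_int (j $ l)) / 2"
    have "negligible {x :: real ^ 'n. x $ l = c}"
      using negligible_standard_hyperplane[of "axis l 1 :: real ^ 'n" c] by (simp add: inner_axis)
    moreover have "{x :: real ^ 'n. x $ l = c} \<in> sets borel" by measurable
    ultimately have "{x :: real ^ 'n. x $ l = c} \<in> null_sets lborel"
      by (simp add: negligible_iff_null_sets null_sets_completion_iff)
    then have "AE x in lborel. x \<notin> {x :: real ^ 'n. x $ l = c}" by (rule AE_not_in)
    then have "AE x in lborel. x \<notin> cell dx i \<or> x \<notin> cell dx j"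
    proof eventually_elim
      fix x assume x: "x \<notin> {x :: real ^ 'n. x $ l = c}"
      show "x \<notin> cell dx i \<or> x \<notin> cell dx j"
      proof (rule ccontr)
        assume "\<not> ?thesis"
        then have d: "\<bar>x $ l / dx - real_of_int (i $ l)\<bar> \<le> 1 / 2" "\<bar>x $ l / dx - real_of_int (j $ l)\<bar> \<le> 1 / 2"
          using cellD by auto
        have "i $ l + 1 \<le> j $ l \<or> j $ l + 1 \<le> i $ l" using l by linarith
        then have "real_of_int (i $ l) + 1 \<le> real_of_int (j $ l) \<or> real_of_int (j $ l) + 1 \<le> real_of_int (i $ l)"
          by linarith
        with d have "x $ l / dx = (real_of_int (i $ l) + real_of_int (j $ l)) / 2"
          by (rule midpoint_unique)
        then have "x $ l = c" using dx by (simp add: c_def field_simps)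
        with x show False by simp
      qed
    qed
    then show ?thesis unfolding m(2) using m(3) by (subst AE_density) (auto elim: eventually_mono)
  qed
  have "measure m (\<Union>i\<in>J. cell dx i) = (\<Sum>i\<in>J. measure m (cell dx i))"
    using overlap by (intro measure_UNION_AE finJ) (auto simp: pairwise_def fmeasurable_eq_sets)
  moreover have "measure m (\<Union>i\<in>J. cell dx i) = 1"
  proof -
    have cover: "x \<in> (\<Union>i\<in>J. cell dx i)" if "x \<in> cball 0 R" for x
    proof -
      \<comment> \<open>Rounding each coordinate to a nearest node.\<close>
      define i :: "int ^ 'n" where "i = (\<chi> l. \<lfloor>x $ l / dx + 1 / 2\<rfloor>)"
      have "\<bar>x $ l / dx - real_of_int (i $ l)\<bar> \<le> 1 / 2" for l unfolding i_def vec_lambda_beta by linarith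
      then have "\<bar>x $ l - real_of_int (i $ l) * dx\<bar> \<le> dx / 2" for l
        using scaled_abs_diff[OF dx, of "x $ l" "real_of_int (i $ l)"] dx by (simp add: field_simps)
      then have "x \<in> cell dx i" by (simp add: mem_cell)
      moreover have "- M \<le> i $ l \<and> i $ l \<le> M" for l
        using comp[OF that, of l] unfolding M_def i_def vec_lambda_beta by linarith
      ultimately show ?thesis by (auto simp: J_def)
    qed
    have "AE x in m. x \<in> (\<Union>i\<in>J. cell dx i)" using inR by eventually_elim (rule cover)
    moreover have "(\<Union>i\<in>J. cell dx i) \<in> events" using finJ by auto
    ultimately show ?thesis by (simp add: prob_eq_1)
  qed
  ultimately show ?thesis using finJ zero by (intro exI[of _ J]) (auto simp: simplex_on_def)
qed

text \<open>The measure is the image of a weighted counting measure on the slots {0..n}, so that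
  atoms occurring in several slots add up their weights automatically.\<close>

lemma finite_mixture:
  fixes a :: "nat \<Rightarrow> 'a::euclidean_space" and w :: "nat \<Rightarrow> real"
  assumes w: "\<And>l. l \<le> n \<Longrightarrow> 0 \<le> w l" "(\<Sum>l\<le>n. w l) = 1"
  shows "\<exists>\<mu>\<in>P1. meas_supp \<mu> \<subseteq> a ` {..n} \<and>
    (\<forall>h::'a \<Rightarrow> real. h \<in> borel_measurable borel \<longrightarrow> (\<integral>x. h x \<partial>\<mu>) = (\<Sum>l\<le>n. w l * h (a l)))"
proof -
  define P where "P = point_measure {..n} (\<lambda>l. ennreal (w l))"
  define \<mu> where "\<mu> = distr P borel a"
  have a [measurable]: "a \<in> P \<rightarrow>\<^sub>M borel" unfolding P_def by simp
  have "emeasure P (space P) = (\<Sum>l\<le>n. ennreal (w l))"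
    unfolding P_def by (subst emeasure_point_measure_finite) (auto simp: space_point_measure)
  also have "\<dots> = 1" using w by (subst sum_ennreal) auto
  finally have P: "prob_space P" by (intro prob_spaceI)
  have int: "integrable P h" for h :: "nat \<Rightarrow> real"
    unfolding P_def by (rule integrable_point_measure_finite) (simp_all)
  have "prob_space \<mu>" unfolding \<mu>_def by (rule prob_space.prob_space_distr[OF P a])
  moreover have "integrable \<mu> norm" unfolding \<mu>_def by (subst integrable_distr_eq) (auto intro: int)
  ultimately have "\<mu> \<in> P1" by (simp add: P1_def \<mu>_def)
  moreover have "meas_supp \<mu> \<subseteq> a ` {..n}"
  proof
    fix x assume x: "x \<in> meas_supp \<mu>"
    show "x \<in> a ` {..n}"
    proof (rule ccontr)
      assume "x \<notin> a ` {..n}"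
      moreover have "open (- a ` {..n})" by (intro open_Compl finite_imp_closed) auto
      ultimately have "emeasure \<mu> (- a ` {..n}) > 0" using x by (auto simp: meas_supp_def)
      moreover have "a -` (- a ` {..n}) \<inter> space P = {}" by (auto simp: P_def space_point_measure)
      ultimately show False using \<open>open (- a ` {..n})\<close> by (simp add: \<mu>_def emeasure_distr)
    qed
  qed
  moreover have "(\<integral>x. h x \<partial>\<mu>) = (\<Sum>l\<le>n. w l * h (a l))" if "h \<in> borel_measurable borel" for h :: "'a \<Rightarrow> real"
  proof -
    have "(\<integral>x. h x \<partial>\<mu>) = (\<integral>l. h (a l) \<partial>P)" unfolding \<mu>_def by (rule integral_distr[OF a that])
    also have "\<dots> = (\<Sum>l\<le>n. w l * h (a l))"
      unfolding P_def by (subst lebesgue_integral_point_measure_finite) (use w in auto)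
    finally show ?thesis .
  qed
  ultimately show ?thesis by blast
qed

section \<open>Existence for the scheme\<close>

theorem proposition3p4:
  fixes F G :: "real ^ 'n \<Rightarrow> (real ^ 'n) measure \<Rightarrow> real"
    and L :: "real ^ 'n \<Rightarrow> real ^ 'n \<Rightarrow> real"
    and m0 :: "(real ^ 'n) measure"
    and rho0 :: "real ^ 'n \<Rightarrow> real"
    and T dx dt c C_F1 C_F2 C_G1 C_G2 C_star C_L1 C_L2 C_L3 C_L4 C_L5 C_H5 C_b :: real
    and N :: nat
  assumes T: "T > 0"
    and F_cont: "continuous_coupling F"
    and G_cont: "continuous_coupling G"
    and G_C2: "\<And>\<eta>. \<eta> \<in> P1 \<Longrightarrow> C2 (\<lambda>x. G x \<eta>)"
    and FG_consts: "C_F1 > 0" "C_F2 > 0" "C_G1 > 0" "C_G2 > 0"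
    and F_bounded: "\<And>\<eta> x. \<eta> \<in> P1 \<Longrightarrow> \<bar>F x \<eta>\<bar> \<le> C_F1"
    and F_lipschitz: "\<And>\<eta> x y. \<eta> \<in> P1 \<Longrightarrow> \<bar>F x \<eta> - F y \<eta>\<bar> \<le> C_F2 * norm (x - y)"
    and G_supp: "\<And>\<eta>. \<eta> \<in> P1 \<Longrightarrow> fun_supp (\<lambda>x. G x \<eta>) \<subseteq> cball 0 C_G1"
    and G_bounded: "\<And>\<eta> x. \<eta> \<in> P1 \<Longrightarrow>
      \<bar>G x \<eta>\<bar> + norm (grad (\<lambda>x. G x \<eta>) x) + onorm (hess (\<lambda>x. G x \<eta>) x) \<le> C_G2"
    and m0_P1: "m0 \<in> P1"
    and m0_density: "m0 = density lborel (\<lambda>x. ennreal (rho0 x))" "\<And>x. rho0 x \<ge> 0" "C2 rho0"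
    and m0_supp: "C_star > 0" "meas_supp m0 \<subseteq> cball 0 C_star"
    and L_C2: "C2 (\<lambda>(x, a). L x a)"
    and L_bdd_below: "bdd_below (range (\<lambda>(x, a). L x a))"
    and L_consts: "C_L1 > 0" "C_L2 > 0" "C_L3 > 0" "C_L4 > 0" "C_L5 > 0"
    and L_growth: "\<And>x a. L x a \<le> C_L1 * (norm a)\<^sup>2 + C_L2"
    and L_grad_x: "\<And>x a. norm (grad (\<lambda>x. L x a) x) \<le> C_L3 * (1 + (norm a)\<^sup>2)"
    and L_hess_a: "\<And>x a b. C_L4 * (norm b)\<^sup>2 \<le> hess (\<lambda>a. L x a) a b \<bullet> b"
    and L_hess_x: "\<And>x a y. hess (\<lambda>x. L x a) x y \<bullet> y \<le> C_L5 * (1 + (norm a)\<^sup>2) * (norm y)\<^sup>2"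
    and C_H5: "C_H5 > 0" "\<And>x p. norm (grad (\<lambda>p. hamiltonian L x p) p) \<le> C_H5 * (1 + norm p)"
    and C_b: "C_b > 0" "bounds_optimal_controls L F G T C_b"
    and mesh: "dx > 0" "dt > 0" "N \<ge> 1" "real N * dt = T"
    and mesh_ratio: "c > 0" "dx < c * dt"
  shows "\<exists>m v. MFG_solution dx dt N (C_b + C_H5 * (C_G2 + 1)) L F G m0 m v"
proof -
  define CH where "CH = C_b + C_H5 * (C_G2 + 1)"
  define K where "K = {a :: real ^ 'n. infnorm a \<le> CH}"
  define \<beta> where "\<beta> j a i = Q1basis dx i (gridpt dx j - dt *\<^sub>R a)" for j i :: "int ^ 'n" and a
  define S where "S = (stencil (dt * CH / dx) :: int ^ 'n \<Rightarrow> _)"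
  have dx: "dx > 0" and dt: "dt > 0" by fact+
  have CH: "CH \<ge> 0" unfolding CH_def using C_b C_H5 FG_consts by (simp add: add_nonneg_nonneg)
  have cpt: "compact K" unfolding K_def using infnorm_le_eq_cbox[of "0 :: real ^ 'n" CH] by simp
  have zK: "0 \<in> K" using CH by (simp add: K_def infnorm_0)
  obtain r where r: "\<And>a. a \<in> K \<Longrightarrow> norm a \<le> r"
    using compact_imp_bounded[OF cpt] unfolding bounded_iff by blast
  \<comment> \<open>Lower bound and quadratic growth bound L on \<open>K\<close> uniformly in x,
    hence over all grid nodes at once.\<close>
  obtain lb where lb: "\<And>x a. lb \<le> L x a" using L_bdd_below unfolding bdd_below_def by auto
  have L_bound: "\<bar>L x a\<bar> \<le> \<bar>lb\<bar> + C_L1 * r\<^sup>2 + C_L2" if "a \<in> K" for x a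
  proof -
    have "C_L1 * (norm a)\<^sup>2 \<le> C_L1 * r\<^sup>2" using r[OF that] L_consts by (intro mult_left_mono power_mono) auto
    moreover have "0 \<le> C_L1 * r\<^sup>2" using L_consts by simp
    ultimately show ?thesis using L_growth[of x a] lb[of x a] L_consts by linarith
  qed
  have L_cont: "continuous_on UNIV (\<lambda>p. L (fst p) (snd p))"
    using L_C2 unfolding C2_def case_prod_beta
    by (auto simp: continuous_on_eq_continuous_at intro: differentiable_imp_continuous_within)
  \<comment> \<open>The hypothesis bounds a sum of three terms. Isolating the first requires the
    operator norm of the Hessian to be nonnegative, which follows from its linearity at a point of
    differentiability of the gradient.\<close>
  have G_abs: "\<bar>G x \<eta>\<bar> \<le> C_G2" if "\<eta> \<in> P1" for x \<eta>
  proof -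
    have "grad (\<lambda>x. G x \<eta>) differentiable (at x)" using G_C2[OF that] unfolding C2_def by blast
    then have "bounded_linear (hess (\<lambda>x. G x \<eta>) x)"
      unfolding hess_def frechet_derivative_works using has_derivative_bounded_linear by blast
    then have "0 \<le> onorm (hess (\<lambda>x. G x \<eta>) x)" by (rule onorm_pos_le)
    then show ?thesis using G_bounded[OF that, of x] norm_ge_zero[of "grad (\<lambda>x. G x \<eta>) x"] by linarith
  qed
  obtain J0 where J0: "finite J0" "(\<lambda>i. measure m0 (cell dx i)) \<in> simplex_on J0"
  proof -
    have "continuous_on UNIV rho0"
      using m0_density(3) unfolding C2_def
      by (auto simp: continuous_on_eq_continuous_at intro: differentiable_imp_continuous_within)
    then have "rho0 \<in> borel_measurable borel" by (rule borel_measurable_continuous_onI)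
    then have "(\<lambda>x. ennreal (rho0 x)) \<in> borel_measurable borel" by measurable
    from cell_mass_simplex[OF dx m0_P1 m0_density(1) this m0_supp(2)] that show thesis by blast
  qed
  define BL where "BL = \<bar>lb\<bar> + C_L1 * r\<^sup>2 + C_L2"
  have BL: "\<bar>L x a\<bar> \<le> BL" if "a \<in> K" for x a using L_bound[OF that] by (simp add: BL_def)
  have BL0: "BL \<ge> 0" using BL[OF zK, of 0] by linarith
  interpret finite_range_mfg K \<beta> S "\<lambda>j a. dt * L (gridpt dx j) a"
    "\<lambda>i z. dt * cell_average dx F i z" "cell_average dx G"
    "\<lambda>i. measure m0 (cell dx i)" J0 N "dt * BL + dt * C_F1 + C_G2"
  proof
    show "compact K" "K \<noteq> {}" using cpt zK by auto
    show "finite (S j)" for j unfolding S_def by (rule finite_stencil)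
    show "0 \<le> \<beta> j a i" for j a i unfolding \<beta>_def by (rule Q1basis_nonneg)
    show "\<beta> j a i = 0" if "a \<in> K" "i \<notin> S j" for j a i
      using that unfolding \<beta>_def S_def K_def by (intro Q1basis_stencil_zero[OF dx dt]) auto
    show "(\<Sum>i\<in>S j. \<beta> j a i) = 1" if "a \<in> K" for j a
      using that unfolding \<beta>_def S_def K_def by (intro Q1basis_stencil_sum[OF dx dt]) auto
    show "continuous_on K (\<lambda>a. \<beta> j a i)" for j i
      unfolding \<beta>_def
      by (rule continuous_on_compose2[OF continuous_on_Q1basis[of UNIV]]) (auto intro!: continuous_intros)
    show "continuous_on K (\<lambda>a. dt * L (gridpt dx j) a)" for j
    proof -
      have "continuous_on K (\<lambda>a. (gridpt dx j, a))"
        by (intro continuous_on_Pair continuous_on_const continuous_on_id)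
      from continuous_on_compose2[OF L_cont this] have "continuous_on K (\<lambda>a. L (gridpt dx j) a)" by simp
      then show ?thesis by (intro continuous_on_mult continuous_on_const)
    qed
    show "\<bar>dt * L (gridpt dx j) a\<bar> \<le> dt * BL + dt * C_F1 + C_G2" if "a \<in> K" for j a
    proof -
      have "\<bar>dt * L (gridpt dx j) a\<bar> \<le> dt * BL" using BL[OF that] dt by (simp add: abs_mult)
      then show ?thesis using dt FG_consts by (simp add: add_increasing2)
    qed
    fix J :: "(int ^ 'n) set" and i assume J: "finite J"
    show "\<bar>dt * cell_average dx F i z\<bar> \<le> dt * BL + dt * C_F1 + C_G2" if "z \<in> simplex_on J" for z
    proof -
      have "\<bar>dt * cell_average dx F i z\<bar> \<le> dt * C_F1"
        using cell_average_bound[OF dx J F_cont F_bounded that] dt by (simp add: abs_mult)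
      moreover have "0 \<le> dt * BL" using dt BL0 by simp
      ultimately show ?thesis using FG_consts by linarith
    qed
    show "\<bar>cell_average dx G i z\<bar> \<le> dt * BL + dt * C_F1 + C_G2" if "z \<in> simplex_on J" for z
    proof -
      have "0 \<le> dt * BL" "0 \<le> dt * C_F1" using dt BL0 FG_consts by simp_all
      then show ?thesis using cell_average_bound[OF dx J G_cont G_abs that, of i] by linarith
    qed
    fix Z and z :: "int ^ 'n \<Rightarrow> real"
    assume Z: "\<And>n. Z n \<in> simplex_on J" "z \<in> simplex_on J" "\<And>j. (\<lambda>n. Z n j) \<longlonglongrightarrow> z j"
    show "(\<lambda>n. dt * cell_average dx F i (Z n)) \<longlonglongrightarrow> dt * cell_average dx F i z"
      by (intro tendsto_mult tendsto_const cell_average_tendsto[OF dx J F_cont F_bounded Z])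
    show "(\<lambda>n. cell_average dx G i (Z n)) \<longlonglongrightarrow> cell_average dx G i z"
      by (rule cell_average_tendsto[OF dx J G_cont G_abs Z])
  qed (use J0 in auto)
  obtain m a w where m0: "m 0 = (\<lambda>i. measure m0 (cell dx i))"
    and m: "\<And>k. k \<le> N \<Longrightarrow> m k \<in> simplex_on (reach k)"
    and aK: "\<And>k j l. \<lbrakk>k < N; l \<le> card (S j)\<rbrakk> \<Longrightarrow> a k j l \<in> K"
    and opt: "\<And>k j l b. \<lbrakk>k < N; l \<le> card (S j); b \<in> K\<rbrakk>
      \<Longrightarrow> Q (value_fun m (Suc k)) j (a k j l) \<le> Q (value_fun m (Suc k)) j b"
    and w: "\<And>k j l. \<lbrakk>k < N; l \<le> card (S j)\<rbrakk> \<Longrightarrow> (0::real) \<le> w k j l"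
      "\<And>k j. k < N \<Longrightarrow> (\<Sum>l\<le>card (S j). w k j l) = 1"
    and step: "\<And>k i. k < N \<Longrightarrow> m (Suc k) i =
      (\<Sum>j\<in>reach k. m k j * (\<Sum>l\<le>card (S j). w k j l * \<beta> j (a k j l) i))"
    using that by (rule equilibrium)
  define v where "v = value_fun m"
  have Q_eq: "interp dx u (gridpt dx j - dt *\<^sub>R b) + dt * L (gridpt dx j) b = Q u j b" if "b \<in> K" for u j b
    using that interp_stencil[OF dx dt, of b CH u j, folded S_def] by (simp add: K_def Q_def \<beta>_def)
  have argmin: "a k j l \<in> argmin_controls dx dt CH L v k j" if "k < N" "l \<le> card (S j)" for k j l
    using aK[OF that] opt[OF that] Q_eq
    by (auto simp: argmin_controls_def is_arg_min_def v_def K_def not_less)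
  \<comment> \<open>Every slot holds a minimiser; slot 0 is taken as the pure control q.\<close>
  have val_eq: "val K (v (Suc k)) j = Q (v (Suc k)) j (a k j 0)" if "k < N" for k j
  proof -
    obtain b where "b \<in> K" "Q (v (Suc k)) j b = val K (v (Suc k)) j" "\<forall>c\<in>K. Q (v (Suc k)) j b \<le> Q (v (Suc k)) j c"
      using val_attained[OF K order_refl, of "v (Suc k)" j] by blast
    moreover have "Q (v (Suc k)) j (a k j 0) \<le> Q (v (Suc k)) j b" if "b \<in> K" for b
      unfolding v_def by (rule opt[OF \<open>k < N\<close> _ that]) simp
    ultimately show ?thesis using aK[OF that, of 0 j] by (metis antisym zero_le)
  qed
  define mixes where "mixes k j \<mu> \<longleftrightarrow> \<mu> \<in> P1 \<and> meas_supp \<mu> \<subseteq> a k j ` {..card (S j)} \<and>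
      (\<forall>h::real ^ 'n \<Rightarrow> real. h \<in> borel_measurable borel \<longrightarrow>
        (\<integral>x. h x \<partial>\<mu>) = (\<Sum>l\<le>card (S j). w k j l * h (a k j l)))" for k j \<mu>
  have "\<exists>\<mu>. mixes k j \<mu>" if "k < N" for k j
    using finite_mixture[of "card (S j)" "w k j" "a k j", OF w(1)[OF that] w(2)[OF that]]
    unfolding mixes_def by blast
  then obtain \<mu> where "\<And>k j. k < N \<Longrightarrow> mixes k j (\<mu> k j)" by metis
  then have \<mu>: "\<And>k j. k < N \<Longrightarrow> \<mu> k j \<in> P1"
      "\<And>k j. k < N \<Longrightarrow> meas_supp (\<mu> k j) \<subseteq> a k j ` {..card (S j)}"
      "\<And>k j (h :: real ^ 'n \<Rightarrow> real). \<lbrakk>k < N; h \<in> borel_measurable borel\<rbrakk> \<Longrightarrow>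
        (\<integral>x. h x \<partial>\<mu> k j) = (\<Sum>l\<le>card (S j). w k j l * h (a k j l))"
    unfolding mixes_def by blast+
  have "MFG_solution dx dt N CH L F G m0 m v"
    unfolding MFG_solution_def
  proof (intro conjI bexI[of _ "\<lambda>k j. a k j 0"] bexI[of _ \<mu>] allI impI)
    show "m \<in> grid_flows N"
      using finite_simplex_on_grid_simplex[OF finite_reach m] by (auto simp: grid_flows_def)
    show "v \<in> grid_bounded N"
      using value_fun_bound[OF m] by (auto simp: grid_bounded_def bounded_iff v_def)
    show "\<mu> \<in> mixed_controls dx dt N CH L v"
      using \<mu>(1,2) argmin by (fastforce simp: mixed_controls_def)
    have "bounded {a k j 0 |k j. k < N}"
      by (rule bounded_subset[OF compact_imp_bounded[OF cpt]]) (use aK in auto)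
    then show "(\<lambda>k j. a k j 0) \<in> pure_controls dx dt N CH L v"
      using argmin by (auto simp: pure_controls_def)
    show "v N i = cell_average dx G i (m N)" for i by (simp add: v_def value_fun_final)
    show "m 0 i = measure m0 (cell dx i)" for i by (simp add: m0)
    fix k i assume k: "k < N"
    show "v k i = interp dx (v (Suc k)) (gridpt dx i - dt *\<^sub>R a k i 0) + dt * L (gridpt dx i) (a k i 0)
        + dt * cell_average dx F i (m k)"
      using value_fun_step[OF k, of m i] val_eq[OF k, of i] Q_eq[OF aK[OF k, of 0 i]] by (simp add: v_def)
    have "(\<lambda>b. Q1basis dx i (gridpt dx j - dt *\<^sub>R b)) \<in> borel_measurable borel" for j
      by (intro borel_measurable_continuous_onI continuous_on_compose2[OF continuous_on_Q1basis[of UNIV]])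
        (auto intro!: continuous_intros)
    then have "(\<integral>b. Q1basis dx i (gridpt dx j - dt *\<^sub>R b) \<partial>\<mu> k j) =
        (\<Sum>l\<le>card (S j). w k j l * \<beta> j (a k j l) i)" for j
      using \<mu>(3)[OF k] by (simp add: \<beta>_def)
    \<comment> \<open>Masses vanish off the reachable nodes, so the infinite transport sum of the
      scheme is the finite one of the equilibrium.\<close>
    moreover have "m k j = 0" if "j \<notin> reach k" for j
      using simplex_onD(2)[OF m that] k by simp
    ultimately show "m (Suc k) i =
        (\<Sum>\<^sub>\<infinity>j. m k j * (\<integral>b. Q1basis dx i (gridpt dx j - dt *\<^sub>R b) \<partial>\<mu> k j))"
      by (subst finite_sum_infsum[OF finite_reach[of k]]) (auto simp: step[OF k])
  qed
  then show ?thesis unfolding CH_def by blast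
qed

end
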